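(* With $Q:=q^{19}$, the following hold: $$4U(1,19,q)U(1,19,q^4)=3\kappa(q)^2\kappa(Q)^2+\kappa(-q)^2\kappa(-Q)^2+4q^5\frac{1}{\kappa(-q^2)^2\kappa(-Q^2)^2},$$ $$4qU(1,19,q)U(1,19,-q)=\kappa(q)^2\kappa(Q)^2-\kappa(-q)^2\kappa(-Q)^2+12q^5\frac{1}{\kappa(-q^2)^2\kappa(-Q^2)^2}.$$
   Context: Let $|q|<1$, $(a;q)_\infty=\prod_{k\ge0}(1-aq^k)$, $(a;q)_n=\prod_{k=0}^{n-1}(1-aq^k)$. $G(q)=\sum_{n\ge0}\frac{q^{n^2}}{(q;q)_n}$, $H(q)=\sum_{n\ge0}\frac{q^{n(n+1)}}{(q;q)_n}$. For positive integers $r,s$ with $s+r\equiv0\pmod 5$, $U(r,s,q)=G(q^r)G(q^s)+q^{(s+r)/5}H(q^r)H(q^s)$; $U(r,s,x)$ denotes this expression with $q$ replaced by $x$ (so $U(1,19,x)=G(x)G(x^{19})+x^4H(x)H(x^{19})$). $\kappa(q)=(-q;q^2)_\infty$. *)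

theory Defs
  imports "HOL-Analysis.Analysis"
begin

definition qpoch :: "complex \<Rightarrow> complex \<Rightarrow> nat \<Rightarrow> complex" where
  "qpoch a q n = (\<Prod>k<n. 1 - a * q ^ k)"

definition qpoch_inf :: "complex \<Rightarrow> complex \<Rightarrow> complex" where
  "qpoch_inf a q = (\<Prod>k. 1 - a * q ^ k)"

definition RR_G :: "complex \<Rightarrow> complex" where
  "RR_G q = (\<Sum>n. q ^ (n ^ 2) / qpoch q q n)"

definition RR_H :: "complex \<Rightarrow> complex" where
  "RR_H q = (\<Sum>n. q ^ (n * (n + 1)) / qpoch q q n)"

(* Only meaningful when r, s are positive and 5 divides s + r, so that the division is exact. *)
definition RR_U :: "nat \<Rightarrow> nat \<Rightarrow> complex \<Rightarrow> complex" where
  "RR_U r s q = RR_G (q ^ r) * RR_G (q ^ s) + q ^ ((s + r) div 5) * RR_H (q ^ r) * RR_H (q ^ s)"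

definition kappa :: "complex \<Rightarrow> complex" where
  "kappa q = qpoch_inf (- q) (q ^ 2)"

end

theory Submission
  imports Defs
begin

text \<open>
  Write $g, h, g_4, h_4, g', h'$ for $G$ and $H$ at $q$, $q^4$ and $-q$, capital letters for the same
  functions of $Q$, and $E = (q^2;q^2)_\infty$. By the Rogers--Ramanujan identities and the Jacobi
  triple product, $g h_4 E$, $h g_4 E$, $g g' E$ and $h h' E$ are single theta functions, and so are
  $(g g_4 \pm q h h_4) E$ and $(g h' \pm g' h) E$. Multiplying out $U(1,19,q)\,U(1,19,q^4)$ and
  $U(1,19,q)\,U(1,19,-q)$ and grouping the factors in this way turns both claims into linear relations
  between products of a theta function of $q$ and one of $Q$, that is, between theta series of
  binary quadratic forms of discriminant $-76$ and $-19$. These are proved by sorting the lattice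
  points by congruence classes.
\<close>

subsection \<open>Dominated convergence\<close>

text \<open>In each product of two U's, multiplied by \<open>E\<close> and its analogue
  \<open>F\<close> in \<open>Q\<close>, one pair of terms is literally a pair of theta products. The
  other pair, p p' + c r r', does not split that way and is obtained by polarisation as half of (p +
  u r)(p' + v r') + (p - u r)(p' - v r'), which requires u v = c. In the first product u = q, v = Q
  and c = q^4 q^16, so q Q = q^20 is where the pair (1,19) enters. The sums p + u r are evaluated by
  dissecting a theta product modulo 5. The differences are the obstacle: only their squares are
  computed, as (X + Y)^2 - 4 X Y with X Y regrouped into known products. The sign of the root stays
  undetermined, which is harmless because a difference at q always occurs together with the same
  difference at Q. Comparing the two signs needs a comparison function without zeros, and
  \<open>q * theta 1 (q ^ 10)\<close> vanishes at 0; hence the separate case q = 0.\<close>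

lemma infsum_tendsto_dominated:
  fixes f :: "'b \<Rightarrow> 'a \<Rightarrow> 'c :: banach"
  assumes lim: "\<And>k. ((\<lambda>y. f y k) \<longlongrightarrow> g k) F"
    and bound: "eventually (\<lambda>y. \<forall>k. norm (f y k) \<le> M k) F"
    and M: "M summable_on UNIV"
  shows "((\<lambda>y. \<Sum>\<^sub>\<infinity>k. f y k) \<longlongrightarrow> (\<Sum>\<^sub>\<infinity>k. g k)) F"
proof (cases "F = bot")
  case False
  \<comment> \<open>On \<open>Y\<close> the M-test makes the finite partial sums converge uniformly,
    which allows the limit along \<open>F\<close> to be exchanged with the limit over finite index
    sets.\<close>
  define Y where "Y = {y. \<forall>k. norm (f y k) \<le> M k}"
  have "uniform_limit Y (\<lambda>X y. \<Sum>k\<in>X. f y k) (\<lambda>y. \<Sum>\<^sub>\<infinity>k. f y k) (finite_subsets_at_top UNIV)"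
    by (rule Weierstrass_m_test_general[where M = M]) (use M in \<open>auto simp: Y_def\<close>)
  moreover have gM: "norm (g k) \<le> M k" for k
    by (rule tendsto_upperbound[OF tendsto_norm[OF lim[of k]]])
       (use bound False in \<open>auto elim: eventually_mono\<close>)
  have "(\<lambda>k. norm (g k)) summable_on UNIV"
    by (rule Infinite_Sum.abs_summable_on_comparison_test'[OF M]) (use gM in auto)
  hence "g summable_on UNIV"
    using abs_summable_summable by blast
  hence "((\<lambda>X. \<Sum>k\<in>X. g k) \<longlongrightarrow> (\<Sum>\<^sub>\<infinity>k. g k)) (finite_subsets_at_top UNIV)"
    using infsum_tendsto by blast
  moreover have "eventually (\<lambda>X. ((\<lambda>y. \<Sum>k\<in>X. f y k) \<longlongrightarrow> (\<Sum>k\<in>X. g k)) F) (finite_subsets_at_top UNIV)"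
    by (intro always_eventually allI tendsto_sum lim)
  ultimately show ?thesis
    using bound False
    by (intro swap_uniform_limit'[where S = Y and f = "\<lambda>X y. \<Sum>k\<in>X. f y k" and F = "finite_subsets_at_top UNIV"])
       (auto simp: Y_def)
qed auto

subsection \<open>q-Pochhammer symbols\<close>

lemma qpoch_0 [simp]: "qpoch a q 0 = 1"
  by (simp add: qpoch_def)

lemma qpoch_Suc: "qpoch a q (Suc n) = qpoch a q n * (1 - a * q ^ n)"
  by (simp add: qpoch_def)

lemma qpoch_add: "qpoch a q (m + k) = qpoch a q m * (\<Prod>i<k. 1 - a * q ^ (m + i))"
  by (induction k) (simp_all add: qpoch_Suc mult_ac)

lemma qpoch_convergent:
  fixes a q :: complex
  assumes "norm q < 1"
  shows "convergent_prod (\<lambda>k. 1 - a * q ^ k)"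
proof -
  have "summable (\<lambda>k. norm ((1 - a * q ^ k) - 1))"
    using summable_mult[OF summable_geometric[of "norm q"], of "norm a"] assms
    by (simp add: norm_mult norm_power)
  thus ?thesis
    by (intro abs_convergent_prod_imp_convergent_prod summable_imp_abs_convergent_prod)
qed

lemma qpoch_LIMSEQ:
  assumes "norm q < 1"
  shows "qpoch a q \<longlonglongrightarrow> qpoch_inf a q"
proof -
  have "(\<lambda>n. \<Prod>k\<le>n. 1 - a * q ^ k) \<longlonglongrightarrow> qpoch_inf a q"
    unfolding qpoch_inf_def by (intro convergent_prod_LIMSEQ qpoch_convergent assms)
  hence "(\<lambda>n. qpoch a q (Suc n)) \<longlonglongrightarrow> qpoch_inf a q"
    by (simp add: qpoch_def lessThan_Suc_atMost)
  thus ?thesis by (rule LIMSEQ_imp_Suc)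
qed

lemma qpoch_factor_nonzero:
  fixes a q :: complex
  assumes "norm q < 1" "norm a < 1"
  shows "1 - a * q ^ k \<noteq> 0"
proof
  assume "1 - a * q ^ k = 0"
  hence "norm a * norm q ^ k = 1"
    by (metis eq_iff_diff_eq_0 norm_mult norm_one norm_power)
  moreover have "norm a * norm q ^ k \<le> norm a * 1"
    using assms by (intro mult_left_mono power_le_one) auto
  ultimately show False using assms by simp
qed

lemma qpoch_nonzero: "norm q < 1 \<Longrightarrow> norm a < 1 \<Longrightarrow> qpoch a q n \<noteq> 0"
  using qpoch_factor_nonzero[of q a] by (auto simp: qpoch_def)

lemma qpoch_inf_nonzero:
  assumes "norm q < 1" "norm a < 1"
  shows "qpoch_inf a q \<noteq> 0"
  unfolding qpoch_inf_def
  by (rule prodinf_nonzero) (use qpoch_convergent qpoch_factor_nonzero assms in auto)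

text \<open>The factors are sorted by exponent modulo \<open>k\<close>. The finite version is exact
  at length \<open>n * k\<close>, so both sides are compared along that subsequence.\<close>

lemma qpoch_inf_split:
  assumes "norm q < 1" "k > 0"
  shows "qpoch_inf a q = (\<Prod>i<k. qpoch_inf (a * q ^ i) (q ^ k))"
proof (rule LIMSEQ_unique)
  have "norm (q ^ k) < 1"
    using assms by (simp add: norm_power power_less_one_iff)
  hence "(\<lambda>n. \<Prod>i<k. qpoch (a * q ^ i) (q ^ k) n) \<longlonglongrightarrow> (\<Prod>i<k. qpoch_inf (a * q ^ i) (q ^ k))"
    by (intro tendsto_prod qpoch_LIMSEQ)
  moreover have "(\<Prod>i<k. qpoch (a * q ^ i) (q ^ k) n) = qpoch a q (n * k)" for n
  proof (induction n)
    case (Suc n)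
    have "qpoch a q (n * k + k) = qpoch a q (n * k) * (\<Prod>i<k. 1 - a * q ^ (n * k + i))"
      by (rule qpoch_add)
    thus ?case
      using Suc by (simp add: qpoch_Suc prod.distrib power_add power_mult mult_ac)
        (simp add: power_mult[symmetric] mult_ac add.commute)
  qed simp
  ultimately show "(\<lambda>n. qpoch a q (n * k)) \<longlonglongrightarrow> (\<Prod>i<k. qpoch_inf (a * q ^ i) (q ^ k))"
    by simp
  have "strict_mono (\<lambda>n. n * k)"
    using assms by (simp add: strict_mono_def)
  thus "(\<lambda>n. qpoch a q (n * k)) \<longlonglongrightarrow> qpoch_inf a q"
    using LIMSEQ_subseq_LIMSEQ[OF qpoch_LIMSEQ[OF assms(1)]] by (simp add: o_def)
qed

lemma qpoch_inf_square:
  assumes "norm q < 1"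
  shows "qpoch_inf a q * qpoch_inf (-a) q = qpoch_inf (a ^ 2) (q ^ 2)"
proof (rule LIMSEQ_unique)
  have "qpoch a q n * qpoch (-a) q n = qpoch (a ^ 2) (q ^ 2) n" for n
    unfolding qpoch_def prod.distrib[symmetric]
    by (intro prod.cong) (auto simp: algebra_simps power2_eq_square power_mult_distrib)
  thus "qpoch (a ^ 2) (q ^ 2) \<longlonglongrightarrow> qpoch_inf a q * qpoch_inf (-a) q"
    using tendsto_mult[OF qpoch_LIMSEQ[OF assms, of a] qpoch_LIMSEQ[OF assms, of "-a"]] by simp
  show "qpoch (a ^ 2) (q ^ 2) \<longlonglongrightarrow> qpoch_inf (a ^ 2) (q ^ 2)"
    using assms by (intro qpoch_LIMSEQ) (simp add: norm_power power_less_one_iff)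
qed

text \<open>Extending $1/(q;q)_n$ by $0$ to negative $n$ lets all finite sums below run over the integers.\<close>

definition iq :: "complex \<Rightarrow> int \<Rightarrow> complex" where
  "iq q n = (if n < 0 then 0 else 1 / qpoch q q (nat n))"

text \<open>No sign condition is needed: for \<open>n \<le> 0\<close> the left side is 0 by
  convention, and on the right \<open>nat n = 0\<close> makes the factor
  \<open>1 - q ^ nat n\<close> vanish.\<close>

lemma iq_pred:
  assumes "norm q < 1"
  shows "iq q (n - 1) = (1 - q ^ nat n) * iq q n"
proof (cases "n > 0")
  case True
  define k where "k = nat (n - 1)"
  have "nat n = Suc k" using True by (simp add: k_def)
  thus ?thesis
    using True qpoch_factor_nonzero[OF assms assms, of k] qpoch_nonzero[OF assms assms, of k]
    by (simp add: iq_def k_def[symmetric] qpoch_Suc)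
qed (auto simp: iq_def)

lemma iq_int [simp]: "iq q (int n) = 1 / qpoch q q n"
  by (simp add: iq_def)

lemma iq_bounded:
  assumes "norm q < 1"
  shows "\<exists>C\<ge>0. \<forall>n. norm (iq q n) \<le> C"
proof -
  have "(\<lambda>n. 1 / qpoch q q n) \<longlonglongrightarrow> 1 / qpoch_inf q q"
    by (intro tendsto_intros qpoch_LIMSEQ qpoch_inf_nonzero assms)
  hence "Bseq (\<lambda>n. 1 / qpoch q q n)" by (metis convergentI convergent_imp_Bseq)
  then obtain C where "C > 0" "\<And>n. norm (1 / qpoch q q n) \<le> C"
    unfolding Bseq_def by blast
  thus ?thesis by (intro exI[of _ C]) (auto simp: iq_def)
qed

lemma iq_LIMSEQ:
  assumes "norm q < 1"
  shows "(\<lambda>n. iq q (int n + c)) \<longlonglongrightarrow> 1 / qpoch_inf q q"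
proof -
  have "(\<lambda>n. iq q (int n)) \<longlonglongrightarrow> 1 / qpoch_inf q q"
    unfolding iq_int by (intro tendsto_intros qpoch_LIMSEQ qpoch_inf_nonzero assms)
  moreover have "filterlim (\<lambda>n. nat (int n + c)) sequentially sequentially"
    by (rule filterlim_at_top_mono[OF filterlim_minus_const_nat_at_top[of "nat (-c)"]])
       (auto intro!: always_eventually)
  ultimately have "(\<lambda>n. iq q (int (nat (int n + c)))) \<longlonglongrightarrow> 1 / qpoch_inf q q"
    by (rule filterlim_compose)
  moreover have "eventually (\<lambda>n. iq q (int (nat (int n + c))) = iq q (int n + c)) sequentially"
    using eventually_ge_at_top[of "nat (-c)"] by eventually_elim auto
  ultimately show ?thesis by (rule Lim_transform_eventually)
qed

subsection \<open>The Jacobi triple product\<close>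

text \<open>The value is nonnegative at every integer, so it can be a natural-number exponent;
  \<open>tri (-n)\<close> is n(n-1)/2, the second exponent of the general theta term. Exponent
  identities are checked after doubling and casting to \<open>int\<close>.\<close>

definition tri :: "int \<Rightarrow> nat" where
  "tri n = nat (n * (n + 1) div 2)"

lemma two_tri: "2 * int (tri n) = n * (n + 1)"
proof -
  have "n * (n + 1) \<ge> 0"
    by (cases "n \<ge> 0") (auto simp: mult_nonpos_nonpos zero_le_mult_iff)
  thus ?thesis by (auto simp: tri_def)
qed

lemma tri_simps [simp]: "tri 0 = 0" "tri (-1) = 0"
  by (simp_all add: tri_def)

definition theta_term :: "complex \<Rightarrow> complex \<Rightarrow> int \<Rightarrow> complex" where
  "theta_term a b n = a ^ tri n * b ^ tri (-n)"

text \<open>Ramanujan's theta function $f(a,b)$.\<close>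

definition theta :: "complex \<Rightarrow> complex \<Rightarrow> complex" where
  "theta a b = (\<Sum>\<^sub>\<infinity>n. theta_term a b n)"

lemma theta_term_uminus: "theta_term a b (-n) = theta_term b a n"
  by (simp add: theta_term_def)

lemma theta_commute: "theta a b = theta b a"
  unfolding theta_def
  by (rule infsum_reindex_bij_witness[of _ uminus uminus]) (auto simp: theta_term_uminus)

text \<open>An equivalent of the q-binomial theorem. Keeping \<open>M\<close> and \<open>N\<close>
  independent lets the induction raise one at a time, and later supplies the unequal pair N, N + 1
  needed for H.\<close>

lemma finite_triple_product:
  fixes a b q :: complex
  assumes q: "q = a * b" "norm q < 1"
  shows "((\<lambda>r. theta_term a b r * iq q (int M - r) * iq q (int N + r)) has_sum
           (qpoch (-a) q M * qpoch (-b) q N / qpoch q q (M + N))) UNIV"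
proof -
  \<comment> \<open>The sum and its shift by one, weighted with \<open>a * q ^ M\<close>, combine
    termwise into the sum for \<open>Suc M\<close>. The variables \<open>a\<close> and
    \<open>b\<close> are quantified afresh because the step is also applied with the two
    exchanged.\<close>
  have step: "((\<lambda>r. theta_term a b r * iq q (int (Suc M) - r) * iq q (int N + r)) has_sum
           (S * (1 + a * q ^ M) / (1 - q ^ (M + N + 1)))) UNIV"
    if q: "q = a * b" "norm q < 1" and S: "((\<lambda>r. theta_term a b r * iq q (int M - r) * iq q (int N + r)) has_sum S) UNIV"
    for a b :: complex and M N :: nat and S
  proof -
    have nz: "1 - q ^ (M + N + 1) \<noteq> 0"
      using qpoch_factor_nonzero[OF q(2) q(2), of "M + N"] by simp
    have "((\<lambda>r. theta_term a b (r - 1) * iq q (int M - (r - 1)) * iq q (int N + (r - 1))) has_sum S) UNIV"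
      using S by (subst has_sum_reindex_bij_witness[of _ "\<lambda>r. r + 1" "\<lambda>r. r - 1" UNIV]) auto
    hence "((\<lambda>r. theta_term a b r * iq q (int M - r) * iq q (int N + r) +
        a * q ^ M * (theta_term a b (r - 1) * iq q (int M - (r - 1)) * iq q (int N + (r - 1)))) has_sum
        (S + a * q ^ M * S)) UNIV"
      by (intro has_sum_add has_sum_cmult_right S)
    moreover have "theta_term a b r * iq q (int M - r) * iq q (int N + r) +
        a * q ^ M * (theta_term a b (r - 1) * iq q (int M - (r - 1)) * iq q (int N + (r - 1)))
        = (1 - q ^ (M + N + 1)) * (theta_term a b r * iq q (int (Suc M) - r) * iq q (int N + r))" for r
    proof (cases "r \<le> int M + 1 \<and> r \<ge> - int N")
      case True
      define i where "i = nat (int M + 1 - r)"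
      define j where "j = nat (int N + r)"
      have ij: "int M + 1 - r = int i" "int N + r = int j" "i + j = M + N + 1"
        using True by (auto simp: i_def j_def)
      have e1: "iq q (int M - r) = (1 - q ^ i) * iq q (int i)"
        using iq_pred[OF q(2), of "int i"] ij by (metis add_diff_cancel_right' diff_add_eq nat_int)
      have e2: "iq q (int N + (r - 1)) = (1 - q ^ j) * iq q (int j)"
        using iq_pred[OF q(2), of "int j"] ij by (metis add_diff_eq nat_int)
      have e3: "iq q (int M - (r - 1)) = iq q (int i)" "iq q (int (Suc M) - r) = iq q (int i)"
        unfolding ij(1)[symmetric] by (simp_all add: algebra_simps del: iq_int)
      have "int (1 + M + tri (r - 1)) = int (i + tri r)" "int (M + tri (-(r - 1))) = int (i + tri (-r))"
        using two_tri[of r] two_tri[of "r - 1"] two_tri[of "-r"] two_tri[of "-(r-1)"] ij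
        by (simp_all add: algebra_simps)
      hence x: "1 + M + tri (r - 1) = i + tri r" "M + tri (-(r - 1)) = i + tri (-r)"
        by linarith+
      have "a * q ^ M * theta_term a b (r - 1) = a ^ (1 + M + tri (r - 1)) * b ^ (M + tri (-(r - 1)))"
        by (simp add: theta_term_def q power_add power_mult_distrib mult_ac)
      also have "\<dots> = q ^ i * theta_term a b r"
        unfolding x by (simp add: theta_term_def q power_add power_mult_distrib mult_ac)
      finally have e4: "a * q ^ M * theta_term a b (r - 1) = q ^ i * theta_term a b r" .
      \<comment> \<open>All that is left is (1 - q^i) + q^i (1 - q^j) = 1 - q^(i+j).\<close>
      have "theta_term a b r * iq q (int M - r) * iq q (int N + r) +
          (a * q ^ M * theta_term a b (r - 1)) * iq q (int M - (r - 1)) * iq q (int N + (r - 1))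
          = (1 - q ^ (i + j)) * (theta_term a b r * iq q (int i) * iq q (int j))"
        unfolding e1 e2 e3 e4 ij(2) by (simp add: algebra_simps power_add del: iq_int)
      thus ?thesis unfolding e3 ij(2,3) by (simp add: algebra_simps del: iq_int)
    qed (auto simp: iq_def)
    ultimately have "((\<lambda>r. (1 - q ^ (M + N + 1)) * (theta_term a b r * iq q (int (Suc M) - r) * iq q (int N + r))) has_sum
        (S + a * q ^ M * S)) UNIV" by simp
    from has_sum_cmult_right[OF this, of "1 / (1 - q ^ (M + N + 1))"]
    have "((\<lambda>r. theta_term a b r * iq q (int (Suc M) - r) * iq q (int N + r)) has_sum
        (1 / (1 - q ^ (M + N + 1)) * (S + a * q ^ M * S))) UNIV"
      using nz unfolding mult.assoc[symmetric] by simp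
    thus ?thesis by (simp add: algebra_simps)
  qed
  have "((\<lambda>r. theta_term a b r * iq q (int 0 - r) * iq q (int N + r)) has_sum
           (qpoch (-b) q N / qpoch q q N)) UNIV" for N
  proof (induction N)
    case 0
    have "((\<lambda>r. theta_term a b r * iq q (int 0 - r) * iq q (int 0 + r)) has_sum
            (\<Sum>r\<in>{0}. theta_term a b r * iq q (int 0 - r) * iq q (int 0 + r))) UNIV"
      by (rule has_sum_finite_neutralI[of "{0}"]) (auto simp: iq_def)
    thus ?case by (simp add: theta_term_def iq_def)
  next
    case (Suc N)
    \<comment> \<open>Reflection \<open>r\<close> to \<open>-r\<close> exchanges \<open>a\<close>
      with \<open>b\<close> and \<open>M\<close> with \<open>N\<close>, so the step in
      \<open>M\<close> also raises \<open>N\<close>.\<close>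
    from Suc have "((\<lambda>r. theta_term b a r * iq q (int N - r) * iq q (int 0 + r)) has_sum
           (qpoch (-b) q N / qpoch q q N)) UNIV"
      by (subst has_sum_reindex_bij_witness[of _ uminus uminus UNIV]) (auto simp: theta_term_uminus mult_ac)
    from step[OF _ q(2) this] q(1)
    have "((\<lambda>r. theta_term b a r * iq q (int (Suc N) - r) * iq q (int 0 + r)) has_sum
           (qpoch (-b) q (Suc N) / qpoch q q (Suc N))) UNIV"
      by (simp add: qpoch_Suc mult_ac)
    thus ?case
      by (subst has_sum_reindex_bij_witness[of _ uminus uminus UNIV]) (auto simp: theta_term_uminus mult_ac)
  qed
  note base = this[of N]
  show ?thesis
  proof (induction M)
    case (Suc M)
    from step[OF q Suc] show ?case
      by (simp add: qpoch_Suc mult_ac)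
  qed (use base in simp)
qed

text \<open>The smaller of the two exponents is \<open>tri (\<bar>n\<bar> - 1)\<close>; that power
  of \<open>a * b\<close> is pulled out and the rest has norm at most 1. The bound depends on
  \<open>s\<close> alone, so it also dominates theta series whose arguments vary.\<close>

lemma norm_theta_term_le:
  assumes "norm a \<le> 1" "norm b \<le> 1" "norm a * norm b \<le> s" "s < 1"
  shows "norm (theta_term a b n) \<le> s ^ tri (\<bar>n\<bar> - 1)"
proof -
  have *: "norm a ^ i * norm b ^ j \<le> s ^ k" if "k \<le> i" "k \<le> j" for i j k
  proof -
    have "norm a ^ i * norm b ^ j \<le> norm a ^ k * norm b ^ k"
      using assms that by (intro mult_mono power_decreasing) auto
    also have "\<dots> \<le> s ^ k"
      using assms unfolding power_mult_distrib[symmetric] by (intro power_mono) auto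
    finally show ?thesis .
  qed
  have "int (tri (\<bar>n\<bar> - 1)) \<le> int (tri n)" "int (tri (\<bar>n\<bar> - 1)) \<le> int (tri (-n))"
    using two_tri[of n] two_tri[of "-n"] two_tri[of "\<bar>n\<bar> - 1"]
    by (cases "n \<ge> 0"; simp add: algebra_simps)+
  thus ?thesis
    unfolding theta_term_def norm_mult norm_power by (intro *) linarith+
qed

lemma summable_power_tri:
  assumes "0 \<le> s" "s < (1::real)"
  shows "(\<lambda>n. s ^ tri (\<bar>n\<bar> - 1)) summable_on UNIV"
proof -
  have nat: "(\<lambda>n. s ^ tri (int n - 1)) summable_on UNIV"
  proof (subst summable_on_UNIV_nonneg_real_iff)
    have geo: "summable (\<lambda>n. s ^ n * (1 / s))"
      using assms by (intro summable_mult2 summable_geometric) auto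
    have le: "s ^ tri (int n - 1) \<le> s ^ n * (1 / s)" if "n \<ge> 3" "s > 0" for n
    proof -
      have "(int n - 1) * int n - 2 * (int n - 1) = (int n - 1) * (int n - 2)"
        by (simp add: algebra_simps)
      also have "\<dots> \<ge> 0" using that by (intro mult_nonneg_nonneg) auto
      finally have "int (n - 1) \<le> int (tri (int n - 1))"
        using two_tri[of "int n - 1"] that by (auto simp: of_nat_diff algebra_simps)
      hence "s ^ tri (int n - 1) \<le> s ^ (n - 1)"
        using assms by (intro power_decreasing) auto
      also have "\<dots> = s ^ n * (1 / s)"
        using that by (cases n) auto
      finally show ?thesis .
    qed
    have "summable (\<lambda>n. s ^ tri (int n - 1))" if "s > 0"
    proof (rule summable_comparison_test_ev[OF _ geo])
      show "eventually (\<lambda>n. norm (s ^ tri (int n - 1)) \<le> s ^ n * (1 / s)) sequentially"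
        using eventually_ge_at_top[of 3] by eventually_elim (use le that in auto)
    qed
    \<comment> \<open>The comparison with a geometric series divided by \<open>s\<close>. For
      \<open>s = 0\<close> only the indices 0 and 1 survive, where the exponent is 0 and
      \<open>0 ^ 0 = 1\<close>.\<close>
    moreover have "summable (\<lambda>n. (0::real) ^ tri (int n - 1))"
    proof (rule summable_finite[of "{0,1}"])
      fix n :: nat assume "n \<notin> {0,1}"
      hence "(int n - 1) * int n > 0" by simp
      hence "tri (int n - 1) > 0" using two_tri[of "int n - 1"] by (simp add: algebra_simps)
      thus "(0::real) ^ tri (int n - 1) = 0" by simp
    qed auto
    ultimately show "summable (\<lambda>n. s ^ tri (int n - 1))"
      using assms by (cases "s = 0") auto
  qed (use assms in auto)
  have "(\<lambda>n. s ^ tri (\<bar>n\<bar> - 1)) summable_on {0..}"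
    using nat by (subst summable_on_reindex_bij_witness[of _ int nat UNIV "\<lambda>n. s ^ tri (int n - 1)"]) auto
  moreover have "(\<lambda>n. s ^ tri (\<bar>n\<bar> - 1)) summable_on {..0}"
    using nat by (subst summable_on_reindex_bij_witness[of _ "\<lambda>n. - int n" "\<lambda>n. nat (-n)" UNIV "\<lambda>n. s ^ tri (int n - 1)"]) auto
  ultimately have "(\<lambda>n. s ^ tri (\<bar>n\<bar> - 1)) summable_on ({0..} \<union> {..0})"
    by (rule summable_on_union)
  thus ?thesis by (simp add: Un_def) (metis (mono_tags, lifting) UNIV_eq_I linorder_linear mem_Collect_eq)
qed

lemma theta_abs_summable:
  assumes "norm a \<le> 1" "norm b \<le> 1" "norm (a * b) < 1"
  shows "(\<lambda>n. norm (theta_term a b n)) summable_on UNIV"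
  by (rule Infinite_Sum.abs_summable_on_comparison_test'[OF summable_power_tri[of "norm (a * b)"]])
     (use assms norm_theta_term_le in \<open>auto simp: norm_mult\<close>)

lemma theta_has_sum:
  assumes "norm a \<le> 1" "norm b \<le> 1" "norm (a * b) < 1"
  shows "(theta_term a b has_sum theta a b) UNIV"
  unfolding theta_def using abs_summable_summable[OF theta_abs_summable[OF assms]] by simp

text \<open>The finite form with \<open>M = N\<close> tending to infinity: each \<open>iq\<close>
  factor tends to \<open>1 / qpoch_inf q q\<close> and stays bounded. Allowing norm 1 in one
  argument covers \<open>theta 1 q\<close> and \<open>theta (-q) (-1)\<close>.\<close>

theorem jacobi_triple_product:
  assumes "norm a \<le> 1" "norm b \<le> 1" "norm (a * b) < 1"
  shows "theta a b = qpoch_inf (-a) (a * b) * qpoch_inf (-b) (a * b) * qpoch_inf (a * b) (a * b)"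
proof -
  define q where "q = a * b"
  have q: "norm q < 1" using assms by (simp add: q_def)
  obtain C where C: "C \<ge> 0" "\<And>n. norm (iq q n) \<le> C"
    using iq_bounded[OF q] by blast
  have "(\<lambda>N. \<Sum>\<^sub>\<infinity>r. theta_term a b r * iq q (int N - r) * iq q (int N + r)) \<longlonglongrightarrow>
        (\<Sum>\<^sub>\<infinity>r. theta_term a b r * (1 / qpoch_inf q q) * (1 / qpoch_inf q q))"
  proof (rule infsum_tendsto_dominated)
    fix r show "(\<lambda>N. theta_term a b r * iq q (int N - r) * iq q (int N + r)) \<longlonglongrightarrow>
                 theta_term a b r * (1 / qpoch_inf q q) * (1 / qpoch_inf q q)"
      using iq_LIMSEQ[OF q, of r] iq_LIMSEQ[OF q, of "-r"] by (intro tendsto_intros) auto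
  next
    show "eventually (\<lambda>N. \<forall>r. norm (theta_term a b r * iq q (int N - r) * iq q (int N + r))
              \<le> norm (theta_term a b r) * (C * C)) sequentially"
      unfolding norm_mult mult.assoc using C
      by (intro always_eventually allI mult_left_mono mult_mono) auto
    show "(\<lambda>r. norm (theta_term a b r) * (C * C)) summable_on UNIV"
      by (intro summable_on_cmult_left theta_abs_summable assms)
  qed
  also have "(\<lambda>N. \<Sum>\<^sub>\<infinity>r. theta_term a b r * iq q (int N - r) * iq q (int N + r)) =
      (\<lambda>N. qpoch (-a) q N * qpoch (-b) q N / qpoch q q (N + N))"
    by (intro ext infsumI finite_triple_product q_def q)
  also have "(\<Sum>\<^sub>\<infinity>r. theta_term a b r * (1 / qpoch_inf q q) * (1 / qpoch_inf q q)) =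
      theta a b * (1 / qpoch_inf q q) * (1 / qpoch_inf q q)"
    unfolding mult.assoc theta_def by (rule infsum_cmult_left') 
  finally have 1: "(\<lambda>N. qpoch (-a) q N * qpoch (-b) q N / qpoch q q (N + N)) \<longlonglongrightarrow>
      theta a b * (1 / qpoch_inf q q) * (1 / qpoch_inf q q)" .
  have "strict_mono (\<lambda>N::nat. N + N)" by (simp add: strict_mono_def)
  from LIMSEQ_subseq_LIMSEQ[OF qpoch_LIMSEQ[OF q] this]
  have "(\<lambda>N. qpoch q q (N + N)) \<longlonglongrightarrow> qpoch_inf q q" by (simp add: o_def)
  hence "(\<lambda>N. qpoch (-a) q N * qpoch (-b) q N / qpoch q q (N + N)) \<longlonglongrightarrow>
      qpoch_inf (-a) q * qpoch_inf (-b) q / qpoch_inf q q"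
    by (intro tendsto_intros qpoch_LIMSEQ q qpoch_inf_nonzero)
  from LIMSEQ_unique[OF 1 this] show ?thesis
    using qpoch_inf_nonzero[OF q q] by (simp add: field_simps q_def)
qed

subsection \<open>The Rogers--Ramanujan identities\<close>

text \<open>The q-Chu-Vandermonde sum with one upper entry sent to infinity. The Pascal rule splits
  the sum for \<open>Suc M\<close> into the sum for \<open>M\<close> and a shifted sum in which
  \<open>c\<close> becomes \<open>Suc c\<close>; hence the induction with \<open>c\<close>
  arbitrary.\<close>

lemma q_vandermonde:
  assumes q: "norm q < 1"
  shows "(\<Sum>i\<le>M. q ^ (i * (i + c)) * iq q (int M - int i) * iq q (int i) * iq q (int i + int c)) =
         iq q (int M) * iq q (int M + int c)"
proof (induction M arbitrary: c)
  case 0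
  show ?case by (simp add: iq_def)
next
  case (Suc M)
  define F where "F = (\<lambda>i. q ^ (i * (i + c)) * iq q (int i + int c))"
  have nz: "1 - q ^ Suc n \<noteq> 0" for n
    using qpoch_factor_nonzero[OF q q, of n] by simp
  \<comment> \<open>The q-Pascal rule for reciprocals, from 1 - q^(M+1) = (1 - q^(M+1-i)) +
    q^(M+1-i) (1 - q^i).\<close>
  have pascal: "(1 - q ^ Suc M) * (iq q (int (Suc M) - int i) * iq q (int i)) =
      iq q (int M - int i) * iq q (int i) + q ^ (Suc M - i) * (iq q (int (Suc M) - int i) * iq q (int i - 1))"
    if "i \<le> Suc M" for i
  proof -
    have "iq q (int M - int i) = (1 - q ^ (Suc M - i)) * iq q (int (Suc M) - int i)"
      using iq_pred[OF q, of "int (Suc M) - int i"] that by (simp add: nat_diff_distrib nat_add_distrib)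
    moreover have "iq q (int i - 1) = (1 - q ^ i) * iq q (int i)"
      using iq_pred[OF q, of "int i"] by simp
    moreover have "q ^ Suc M = q ^ (Suc M - i) * q ^ i"
      using that by (simp flip: power_add)
    ultimately show ?thesis unfolding \<open>q ^ Suc M = _\<close> by (simp only: ring_distribs mult_ac) simp
  qed
  have "(1 - q ^ Suc M) * (\<Sum>i\<le>Suc M. q ^ (i * (i + c)) * iq q (int (Suc M) - int i) * iq q (int i) * iq q (int i + int c))
      = (\<Sum>i\<le>Suc M. F i * ((1 - q ^ Suc M) * (iq q (int (Suc M) - int i) * iq q (int i))))"
    by (simp only: sum_distrib_left F_def mult_ac)
  also have "\<dots> = (\<Sum>i\<le>Suc M. F i * (iq q (int M - int i) * iq q (int i))) +
      (\<Sum>i\<le>Suc M. F i * (q ^ (Suc M - i) * (iq q (int (Suc M) - int i) * iq q (int i - 1))))"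
    unfolding sum.distrib[symmetric] by (intro sum.cong refl) (simp only: pascal distrib_left atMost_iff)
  also have "(\<Sum>i\<le>Suc M. F i * (iq q (int M - int i) * iq q (int i))) =
      (\<Sum>i\<le>M. q ^ (i * (i + c)) * iq q (int M - int i) * iq q (int i) * iq q (int i + int c))"
    by (simp add: iq_def F_def mult_ac)
  also have "\<dots> = iq q (int M) * iq q (int M + int c)" by (rule Suc)
  also have "(\<Sum>i\<le>Suc M. F i * (q ^ (Suc M - i) * (iq q (int (Suc M) - int i) * iq q (int i - 1)))) =
      (\<Sum>i\<le>M. F (Suc i) * (q ^ (M - i) * (iq q (int M - int i) * iq q (int i))))"
    by (subst sum.atMost_Suc_shift) (simp add: iq_def)
  also have "\<dots> = (\<Sum>i\<le>M. q ^ (Suc M + c) * (q ^ (i * (i + Suc c)) * iq q (int M - int i) * iq q (int i) * iq q (int i + int (Suc c))))"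
  proof (intro sum.cong refl)
    fix i assume "i \<in> {..M}"
    hence "Suc i * (Suc i + c) + (M - i) = Suc M + c + i * (i + Suc c)"
      by (auto simp: algebra_simps)
    hence "q ^ (Suc i * (Suc i + c)) * q ^ (M - i) = q ^ (Suc M + c) * q ^ (i * (i + Suc c))"
      by (metis power_add)
    thus "F (Suc i) * (q ^ (M - i) * (iq q (int M - int i) * iq q (int i))) =
        q ^ (Suc M + c) * (q ^ (i * (i + Suc c)) * iq q (int M - int i) * iq q (int i) * iq q (int i + int (Suc c)))"
      unfolding F_def by (simp add: algebra_simps del: iq_int power_Suc)
  qed
  also have "\<dots> = q ^ (Suc M + c) * (iq q (int M) * iq q (int M + int (Suc c)))"
    unfolding sum_distrib_left[symmetric] Suc ..
  also have "iq q (int M) * iq q (int M + int c) + q ^ (Suc M + c) * (iq q (int M) * iq q (int M + int (Suc c)))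
     = (1 - q ^ Suc M) * (iq q (int (Suc M)) * iq q (int (Suc M) + int c))"
  proof -
    have e1: "iq q (int M) = (1 - q ^ Suc M) * iq q (int (Suc M))"
      using iq_pred[OF q, of "int (Suc M)"] unfolding nat_int by simp
    have e2: "iq q (int M + int c) = (1 - q ^ (Suc M + c)) * iq q (int M + int (Suc c))"
      using iq_pred[OF q, of "int (Suc M + c)"] by (simp add: algebra_simps nat_add_distrib del: iq_int)
    have "int (Suc M) + int c = int M + int (Suc c)" by simp
    hence "(1 - q ^ Suc M) * (iq q (int (Suc M)) * iq q (int (Suc M) + int c)) = iq q (int M) * iq q (int M + int (Suc c))"
      unfolding e1 by (simp only: mult_ac)
    thus ?thesis unfolding e2 by (simp add: left_diff_distrib right_diff_distrib mult_ac del: iq_int power_Suc)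
  qed
  finally show ?case using nz by (simp del: iq_int power_Suc)
qed

text \<open>For \<open>r = int k\<close> the shift s = k + i gives s(s+m) = k(k+m) + i(i+2k+m),
  which is the q-Vandermonde sum with \<open>c = 2 * k + m\<close>. Negative \<open>r\<close>
  reduces to this by \<open>r\<close> to \<open>-r - m\<close>, which swaps the two
  \<open>iq\<close> factors and fixes r(r+m).\<close>

lemma bailey_kernel:
  assumes q: "norm q < 1" and m: "m \<le> 1"
  shows "(\<Sum>s\<le>N. q ^ (s * (s + m)) * iq q (int N - int s) * (iq q (int s - r) * iq q (int s + int m + r))) =
         q ^ nat (r * (r + int m)) * (iq q (int N - r) * iq q (int N + int m + r))"
proof -
  have *: "(\<Sum>s\<le>N. q ^ (s * (s + m)) * iq q (int N - int s) * (iq q (int s - int k) * iq q (int s + int m + int k))) =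
         q ^ (k * (k + m)) * (iq q (int N - int k) * iq q (int N + int m + int k))" for k
  proof (cases "k \<le> N")
    case True
    define M where "M = N - k"
    have N: "N = k + M" using True by (simp add: M_def)
    have "(\<Sum>s\<le>N. q ^ (s * (s + m)) * iq q (int N - int s) * (iq q (int s - int k) * iq q (int s + int m + int k))) =
        (\<Sum>s\<in>{k..N}. q ^ (s * (s + m)) * iq q (int N - int s) * (iq q (int s - int k) * iq q (int s + int m + int k)))"
      by (rule sum.mono_neutral_right) (auto simp: iq_def)
    also have "\<dots> = (\<Sum>i\<le>M. q ^ ((k + i) * (k + i + m)) * iq q (int N - int (k + i)) * (iq q (int (k + i) - int k) * iq q (int (k + i) + int m + int k)))"
      by (rule sum.reindex_bij_witness[of _ "\<lambda>i. k + i" "\<lambda>s. s - k"]) (auto simp: N)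
    also have "\<dots> = (\<Sum>i\<le>M. q ^ (k * (k + m)) * (q ^ (i * (i + (2 * k + m))) * iq q (int M - int i) * iq q (int i) * iq q (int i + int (2 * k + m))))"
    proof (intro sum.cong refl)
      fix i
      have "(k + i) * (k + i + m) = k * (k + m) + i * (i + (2 * k + m))"
        by (simp add: algebra_simps)
      hence "q ^ ((k + i) * (k + i + m)) = q ^ (k * (k + m)) * q ^ (i * (i + (2 * k + m)))"
        by (simp add: power_add)
      moreover have "int (k + i) + int m + int k = int i + int (2 * k + m)" "int N - int (k + i) = int M - int i" "int (k + i) - int k = int i"
        by (simp_all add: N)
      ultimately show "q ^ ((k + i) * (k + i + m)) * iq q (int N - int (k + i)) * (iq q (int (k + i) - int k) * iq q (int (k + i) + int m + int k))
        = q ^ (k * (k + m)) * (q ^ (i * (i + (2 * k + m))) * iq q (int M - int i) * iq q (int i) * iq q (int i + int (2 * k + m)))"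
        by (simp only: mult_ac)
    qed
    also have "\<dots> = q ^ (k * (k + m)) * (iq q (int M) * iq q (int M + int (2 * k + m)))"
      unfolding sum_distrib_left[symmetric] q_vandermonde[OF q] ..
    also have "int M + int (2 * k + m) = int N + int m + int k"
      by (simp add: N)
    also have "int M = int N - int k"
      by (simp add: N)
    finally show ?thesis .
  next
    case False
    hence "(\<Sum>s\<le>N. q ^ (s * (s + m)) * iq q (int N - int s) * (iq q (int s - int k) * iq q (int s + int m + int k))) = 0"
      by (intro sum.neutral) (auto simp: iq_def)
    thus ?thesis using False by (simp add: iq_def)
  qed
  show ?thesis
  proof (cases "r \<ge> 0")
    case True
    then obtain k where k: "r = int k" by (metis nonneg_int_cases)
    have "nat (r * (r + int m)) = k * (k + m)"
      unfolding k by (metis nat_int of_nat_add of_nat_mult)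
    thus ?thesis using *[of k] k by simp
  next
    case False
    \<comment> \<open>Here \<open>m \<le> 1\<close> matters: it makes \<open>- r - int m\<close>
      nonnegative for every negative \<open>r\<close>.\<close>
    with m obtain k where k: "- r - int m = int k" by (metis diff_ge_0_iff_ge nonneg_int_cases minus_le_iff not_le int_one_le_iff_zero_less neg_0_less_iff_less of_nat_1 of_nat_le_iff order_trans)
    have r: "r = - int k - int m" using k by simp
    have "nat (r * (r + int m)) = nat (int (k * (k + m)))"
      unfolding r by (rule arg_cong[of _ _ nat]) (simp add: algebra_simps)
    hence "nat (r * (r + int m)) = k * (k + m)" by (simp only: nat_int)
    moreover have "int s - r = int s + int m + int k" "int s + int m + r = int s - int k" for s
      by (simp_all add: r)
    ultimately show ?thesis using *[of k] by (simp only: mult_ac)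
  qed
qed

text \<open>Bailey's lemma at a = q^m with both free parameters sent to infinity: interchange the
  finite sum over \<open>s\<close> with the sum over \<open>r\<close> and apply the kernel
  identity.\<close>

lemma bailey_step:
  assumes q: "norm q < 1" and m: "m \<le> 1"
    and S: "\<And>N. ((\<lambda>r. \<alpha> r * (iq q (int N - r) * iq q (int N + int m + r))) has_sum \<beta> N) UNIV"
  shows "((\<lambda>r. q ^ nat (r * (r + int m)) * \<alpha> r * (iq q (int N - r) * iq q (int N + int m + r))) has_sum
           (\<Sum>s\<le>N. q ^ (s * (s + m)) * iq q (int N - int s) * \<beta> s)) UNIV"
proof -
  have "((\<lambda>r. \<Sum>s\<in>I. q ^ (s * (s + m)) * iq q (int N - int s) * (\<alpha> r * (iq q (int s - r) * iq q (int s + int m + r)))) has_sum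
      (\<Sum>s\<in>I. q ^ (s * (s + m)) * iq q (int N - int s) * \<beta> s)) UNIV" if "finite I" for I
    using that by induction (auto intro!: has_sum_add has_sum_cmult_right S simp del: iq_int)
  from this[of "{..N}"] have "((\<lambda>r. \<Sum>s\<le>N. q ^ (s * (s + m)) * iq q (int N - int s) * (\<alpha> r * (iq q (int s - r) * iq q (int s + int m + r)))) has_sum
      (\<Sum>s\<le>N. q ^ (s * (s + m)) * iq q (int N - int s) * \<beta> s)) UNIV" by simp
  moreover have "(\<Sum>s\<le>N. q ^ (s * (s + m)) * iq q (int N - int s) * (\<alpha> r * (iq q (int s - r) * iq q (int s + int m + r)))) =
      q ^ nat (r * (r + int m)) * \<alpha> r * (iq q (int N - r) * iq q (int N + int m + r))" for r
  proof -
    have "(\<Sum>s\<le>N. q ^ (s * (s + m)) * iq q (int N - int s) * (\<alpha> r * (iq q (int s - r) * iq q (int s + int m + r)))) =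
      \<alpha> r * (\<Sum>s\<le>N. q ^ (s * (s + m)) * iq q (int N - int s) * (iq q (int s - r) * iq q (int s + int m + r)))"
      unfolding sum_distrib_left by (simp only: mult_ac)
    thus ?thesis unfolding bailey_kernel[OF q m] by (simp only: mult_ac)
  qed
  ultimately show ?thesis by simp
qed

text \<open>The unit Bailey pair $\alpha_r = (-1)^r q^{r(r-1)/2}$, $\beta_N = \delta_{N,0}$ is the case
  $a = -1$ of the finite triple product; two Bailey steps turn it into the two identities,
  for $m = 0$ and $m = 1$.\<close>

lemma rogers_ramanujan_aux:
  assumes q: "norm q < 1" and m: "m \<le> 1"
    and summable: "(\<lambda>r. norm (q ^ nat (r * (r + int m)) * (q ^ nat (r * (r + int m)) * theta_term (-1) (-q) r))) summable_on UNIV"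
  shows "(\<Sum>s. q ^ (s * (s + m)) / qpoch q q s) * qpoch_inf q q =
     (\<Sum>\<^sub>\<infinity>r. q ^ nat (r * (r + int m)) * (q ^ nat (r * (r + int m)) * theta_term (-1) (-q) r))"
proof -
  let ?e = "\<lambda>r. q ^ nat (r * (r + int m))"
  let ?E = "qpoch_inf q q"
  have nzE: "?E \<noteq> 0" using qpoch_inf_nonzero q by blast
  obtain C where C: "C \<ge> 0" "\<And>n. norm (iq q n) \<le> C"
    using iq_bounded[OF q] by blast
  have "((\<lambda>r. theta_term (-1) (-q) r * (iq q (int N - r) * iq q (int N + int m + r))) has_sum (if N = 0 then 1 else 0)) UNIV" for N
  proof -
    \<comment> \<open>The factor with index 0 is 1 - 1, so every nonempty product vanishes.\<close>
    have "qpoch 1 q N = (if N = 0 then 1 else 0)"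
      by (induction N) (auto simp: qpoch_Suc)
    thus ?thesis
      using finite_triple_product[of q "-1" "-q" N "N + m"] q qpoch_nonzero[OF q q, of m]
      by (simp add: mult.assoc split: if_splits)
  qed
  from bailey_step[OF q m this]
  have "((\<lambda>r. ?e r * theta_term (-1) (-q) r * (iq q (int N - r) * iq q (int N + int m + r))) has_sum iq q (int N)) UNIV" for N
    by (simp add: sum.delta if_distrib cong: if_cong)
  from bailey_step[OF q m this]
  have *: "((\<lambda>r. ?e r * (?e r * theta_term (-1) (-q) r) * (iq q (int N - r) * iq q (int N + int m + r))) has_sum
      (\<Sum>s\<le>N. q ^ (s * (s + m)) * iq q (int N - int s) * iq q (int s))) UNIV" for N .
  have "(\<lambda>N. \<Sum>\<^sub>\<infinity>r. ?e r * (?e r * theta_term (-1) (-q) r) * (iq q (int N - r) * iq q (int N + int m + r))) \<longlonglongrightarrow>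
        (\<Sum>\<^sub>\<infinity>r. ?e r * (?e r * theta_term (-1) (-q) r) * (1 / ?E * (1 / ?E)))"
  proof (rule infsum_tendsto_dominated)
    fix r show "(\<lambda>N. ?e r * (?e r * theta_term (-1) (-q) r) * (iq q (int N - r) * iq q (int N + int m + r))) \<longlonglongrightarrow>
                 ?e r * (?e r * theta_term (-1) (-q) r) * (1 / ?E * (1 / ?E))"
      using iq_LIMSEQ[OF q, of "int m + r"] iq_LIMSEQ[OF q, of "-r"] by (intro tendsto_intros) (auto simp: add_ac)
  next
    show "eventually (\<lambda>N. \<forall>r. norm (?e r * (?e r * theta_term (-1) (-q) r) * (iq q (int N - r) * iq q (int N + int m + r)))
              \<le> norm (?e r * (?e r * theta_term (-1) (-q) r)) * (C * C)) sequentially"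
      unfolding norm_mult using C
      by (intro always_eventually allI mult_left_mono mult_mono) auto
    show "(\<lambda>r. norm (?e r * (?e r * theta_term (-1) (-q) r)) * (C * C)) summable_on UNIV"
      by (intro summable_on_cmult_left summable)
  qed
  also have "(\<lambda>N. \<Sum>\<^sub>\<infinity>r. ?e r * (?e r * theta_term (-1) (-q) r) * (iq q (int N - r) * iq q (int N + int m + r))) =
      (\<lambda>N. \<Sum>s\<le>N. q ^ (s * (s + m)) * iq q (int N - int s) * iq q (int s))"
    by (intro ext infsumI *)
  \<comment> \<open>Since \<open>iq q (int N - int s)\<close> is 0 for \<open>s > N\<close>, the
    finite sum is already a series, and Tannery's theorem can take the limit inside it.\<close>
  also have "\<dots> = (\<lambda>N. \<Sum>s. q ^ (s * (s + m)) * iq q (int N - int s) * iq q (int s))"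
    by (intro ext suminf_finite[symmetric]) (auto simp: iq_def)
  finally have 1: "(\<lambda>N. \<Sum>s. q ^ (s * (s + m)) * iq q (int N - int s) * iq q (int s)) \<longlonglongrightarrow>
       (\<Sum>\<^sub>\<infinity>r. ?e r * (?e r * theta_term (-1) (-q) r) * (1 / ?E * (1 / ?E)))" .
  have "summable (\<lambda>s. norm q ^ s * (C * C))"
    using q by (intro summable_mult2 summable_geometric) auto
  moreover have "norm (q ^ (s * (s + m)) * iq q (int N - int s) * iq q (int s)) \<le> norm q ^ s * (C * C)" for s N
  proof -
    have "norm q ^ (s * (s + m)) \<le> norm q ^ s"
      using q by (intro power_decreasing) (cases s; auto)+
    thus ?thesis
      unfolding norm_mult norm_power mult.assoc using C
      by (intro mult_mono) (auto simp del: iq_int)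
  qed
  ultimately have 2: "(\<lambda>N. \<Sum>s. q ^ (s * (s + m)) * iq q (int N - int s) * iq q (int s)) \<longlonglongrightarrow>
      (\<Sum>s. q ^ (s * (s + m)) * (1 / ?E) * iq q (int s))"
    using iq_LIMSEQ[OF q, of "- int _"]
    by (intro tannerys_theorem[THEN conjunct2, THEN conjunct2] tendsto_intros)
       (auto simp: case_prod_beta intro!: always_eventually simp del: iq_int)
  have sum: "summable (\<lambda>s. q ^ (s * (s + m)) / qpoch q q s)"
  proof (rule summable_comparison_test)
    show "summable (\<lambda>s. norm q ^ s * C)"
      using q by (intro summable_mult2 summable_geometric) auto
    have "norm (q ^ (s * (s + m)) / qpoch q q s) \<le> norm q ^ s * C" for s
    proof -
      have "norm q ^ (s * (s + m)) \<le> norm q ^ s"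
        using q by (intro power_decreasing) (cases s; auto)+
      moreover have "norm (1 / qpoch q q s) \<le> C" using C(2)[of "int s"] by simp
      ultimately have "norm q ^ (s * (s + m)) * norm (1 / qpoch q q s) \<le> norm q ^ s * C"
        using C by (intro mult_mono) auto
      thus ?thesis by (simp add: norm_divide norm_power)
    qed
    thus "\<exists>N. \<forall>n\<ge>N. norm (q ^ (n * (n + m)) / qpoch q q n) \<le> norm q ^ n * C" by blast
  qed
  have "(\<Sum>s. q ^ (s * (s + m)) * (1 / ?E) * iq q (int s)) = (\<Sum>s. 1 / ?E * (q ^ (s * (s + m)) / qpoch q q s))"
    by (simp add: mult_ac)
  also have "\<dots> = 1 / ?E * (\<Sum>s. q ^ (s * (s + m)) / qpoch q q s)"
    by (rule suminf_mult[OF sum])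
  finally have "1 / ?E * (\<Sum>s. q ^ (s * (s + m)) / qpoch q q s) =
      (\<Sum>\<^sub>\<infinity>r. ?e r * (?e r * theta_term (-1) (-q) r) * (1 / ?E * (1 / ?E)))"
    using LIMSEQ_unique[OF 1 2] by simp
  also have "\<dots> = (\<Sum>\<^sub>\<infinity>r. ?e r * (?e r * theta_term (-1) (-q) r)) * (1 / ?E * (1 / ?E))"
    by (rule infsum_cmult_left')
  finally show ?thesis using nzE by (simp add: field_simps)
qed

theorem rogers_ramanujan_G:
  assumes q: "norm q < 1"
  shows "RR_G q * qpoch_inf q q = theta (-(q ^ 2)) (-(q ^ 3))"
proof -
  have summand: "q ^ nat (r * (r + int 0)) * (q ^ nat (r * (r + int 0)) * theta_term (-1) (-q) r) =
      theta_term (-(q ^ 2)) (-(q ^ 3)) r" for r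
  proof -
    have "int (nat (r * (r + int 0)) + nat (r * (r + int 0)) + tri (-r)) = int (2 * tri r + 3 * tri (-r))"
      using two_tri[of r] two_tri[of "-r"] by (simp add: algebra_simps)
    hence *: "nat (r * (r + int 0)) + nat (r * (r + int 0)) + tri (-r) = 2 * tri r + 3 * tri (-r)"
      by linarith
    have "q ^ nat (r * (r + int 0)) * (q ^ nat (r * (r + int 0)) * theta_term (-1) (-q) r) =
        (-1) ^ tri r * (-1) ^ tri (-r) * q ^ (nat (r * (r + int 0)) + nat (r * (r + int 0)) + tri (-r))"
      by (simp add: theta_term_def power_add power_minus[of q] mult_ac)
    also have "\<dots> = theta_term (-(q ^ 2)) (-(q ^ 3)) r"
      unfolding * theta_term_def power_add power_mult power_minus[of "q ^ _"] by (simp only: mult_ac)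
    finally show ?thesis .
  qed
  have "norm (q ^ 2) \<le> 1" "norm (q ^ 3) \<le> 1" "norm (q ^ 2 * q ^ 3) < 1"
    using q by (auto simp: norm_power power_le_one power_less_one_iff simp flip: power_add)
  hence "(\<lambda>r. norm (theta_term (-(q ^ 2)) (-(q ^ 3)) r)) summable_on UNIV"
    by (intro theta_abs_summable) auto
  from rogers_ramanujan_aux[OF q, of 0, unfolded summand, OF _ this]
  show ?thesis by (simp add: RR_G_def theta_def power2_eq_square)
qed

theorem rogers_ramanujan_H:
  assumes q: "norm q < 1"
  shows "RR_H q * qpoch_inf q q = theta (-q) (-(q ^ 4))"
proof -
  have summand: "q ^ nat (r * (r + int 1)) * (q ^ nat (r * (r + int 1)) * theta_term (-1) (-q) r) =
      theta_term (-(q ^ 4)) (-q) r" for r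
  proof -
    have "int (nat (r * (r + int 1)) + nat (r * (r + int 1)) + tri (-r)) = int (4 * tri r + tri (-r))"
      using two_tri[of r] by (simp add: algebra_simps)
    hence *: "nat (r * (r + int 1)) + nat (r * (r + int 1)) + tri (-r) = 4 * tri r + tri (-r)"
      by linarith
    have "q ^ nat (r * (r + int 1)) * (q ^ nat (r * (r + int 1)) * theta_term (-1) (-q) r) =
        (-1) ^ tri r * (-1) ^ tri (-r) * q ^ (nat (r * (r + int 1)) + nat (r * (r + int 1)) + tri (-r))"
      by (simp add: theta_term_def power_add power_minus[of q] mult_ac)
    also have "\<dots> = theta_term (-(q ^ 4)) (-q) r"
      unfolding * theta_term_def power_add power_mult power_minus[of "q ^ _"] power_minus[of q] by (simp only: mult_ac)
    finally show ?thesis .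
  qed
  have "norm (q ^ 4) \<le> 1" "norm q \<le> 1" "norm (q ^ 4 * q) < 1"
    using q by (auto simp: norm_power power_le_one power_less_one_iff simp flip: power_Suc2)
  hence "(\<lambda>r. norm (theta_term (-(q ^ 4)) (-q) r)) summable_on UNIV"
    by (intro theta_abs_summable) auto
  from rogers_ramanujan_aux[OF q, of 1, unfolded summand, OF _ this]
  show ?thesis unfolding theta_commute[of "-q"] by (simp add: RR_H_def theta_def)
qed

subsection \<open>Product identities\<close>

lemma norm_power_lt_1: "norm q < 1 \<Longrightarrow> k > 0 \<Longrightarrow> norm (q ^ k) < 1" for q :: complex
  by (simp add: norm_power power_less_one_iff)

lemma qpoch_inf_split2:
  assumes "norm q < 1"
  shows "qpoch_inf a q = qpoch_inf a (q ^ 2) * qpoch_inf (a * q) (q ^ 2)"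
  using qpoch_inf_split[OF assms, of 2 a] by (simp add: numeral_2_eq_2)

lemma qpoch_inf_split_power:
  assumes "norm q < 1" "k > 0"
  shows "qpoch_inf (c * q ^ i) (q ^ k) = qpoch_inf (c * q ^ i) (q ^ (2 * k)) * qpoch_inf (c * q ^ (i + k)) (q ^ (2 * k))"
  using qpoch_inf_split2[OF norm_power_lt_1[OF assms], of "c * q ^ i"]
  by (simp add: power_add power_mult mult_ac flip: power_mult)

lemma euler_odd_distinct:
  assumes "norm q < 1"
  shows "qpoch_inf (-q) q * qpoch_inf q (q ^ 2) = 1"
proof -
  have q2: "norm (q ^ 2) < 1" using assms by (simp add: norm_power_lt_1)
  have "qpoch_inf q q = qpoch_inf q (q ^ 2) * qpoch_inf (q ^ 2) (q ^ 2)"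
    using qpoch_inf_split2[OF assms, of q] by (simp add: power2_eq_square)
  moreover have "qpoch_inf q q * qpoch_inf (-q) q = qpoch_inf (q ^ 2) (q ^ 2)"
    by (rule qpoch_inf_square[OF assms])
  ultimately have "qpoch_inf (q ^ 2) (q ^ 2) * (qpoch_inf (-q) q * qpoch_inf q (q ^ 2)) = qpoch_inf (q ^ 2) (q ^ 2) * 1"
    by (simp add: mult_ac)
  thus ?thesis using qpoch_inf_nonzero[OF q2 q2] by simp
qed

lemma theta_powers:
  assumes "norm q < 1" "i > 0" "j > 0" "norm c = 1" "norm d = 1" "c * d = 1"
  shows "theta (c * q ^ i) (d * q ^ j) =
    qpoch_inf (- (c * q ^ i)) (q ^ (i + j)) * qpoch_inf (- (d * q ^ j)) (q ^ (i + j)) * qpoch_inf (q ^ (i + j)) (q ^ (i + j))"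
proof -
  have "c * q ^ i * (d * q ^ j) = c * d * q ^ (i + j)" by (simp add: power_add)
  hence "c * q ^ i * (d * q ^ j) = q ^ (i + j)" using assms by simp
  thus ?thesis
    using jacobi_triple_product[of "c * q ^ i" "d * q ^ j"] norm_power_lt_1[OF assms(1), of i] norm_power_lt_1[OF assms(1), of j]
      norm_power_lt_1[OF assms(1), of "i + j"] assms
    by (simp add: norm_mult)
qed

text \<open>Splitting \<open>qpoch_inf q q\<close> modulo 5 cancels the three factors of the theta
  product and leaves the two missing residue classes.\<close>

lemma RR_G_product:
  assumes q: "norm q < 1"
  shows "RR_G q * (qpoch_inf q (q ^ 5) * qpoch_inf (q ^ 4) (q ^ 5)) = 1"
    and "RR_H q * (qpoch_inf (q ^ 2) (q ^ 5) * qpoch_inf (q ^ 3) (q ^ 5)) = 1"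
proof -
  have E: "qpoch_inf q q = qpoch_inf q (q ^ 5) * qpoch_inf (q ^ 2) (q ^ 5) * qpoch_inf (q ^ 3) (q ^ 5) *
      qpoch_inf (q ^ 4) (q ^ 5) * qpoch_inf (q ^ 5) (q ^ 5)"
    using qpoch_inf_split[OF q, of 5 q] by (simp add: eval_nat_numeral)
  have nz: "qpoch_inf (q ^ i) (q ^ 5) \<noteq> 0" if "i > 0" for i
    using that q by (intro qpoch_inf_nonzero norm_power_lt_1) auto
  have nz1: "qpoch_inf q (q ^ 5) \<noteq> 0" using nz[of 1] by simp
  have "theta (-(q ^ 2)) (-(q ^ 3)) = qpoch_inf (q ^ 2) (q ^ 5) * qpoch_inf (q ^ 3) (q ^ 5) * qpoch_inf (q ^ 5) (q ^ 5)"
    using theta_powers[OF q, of 2 3 "-1" "-1"] by simp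
  thus "RR_G q * (qpoch_inf q (q ^ 5) * qpoch_inf (q ^ 4) (q ^ 5)) = 1"
    using rogers_ramanujan_G[OF q] nz[of 2] nz[of 3] nz[of 5] unfolding E by (simp add: mult_ac)
  have "theta (-q) (-(q ^ 4)) = qpoch_inf q (q ^ 5) * qpoch_inf (q ^ 4) (q ^ 5) * qpoch_inf (q ^ 5) (q ^ 5)"
    using theta_powers[OF q, of 1 4 "-1" "-1"] by simp
  thus "RR_H q * (qpoch_inf (q ^ 2) (q ^ 5) * qpoch_inf (q ^ 3) (q ^ 5)) = 1"
    using rogers_ramanujan_H[OF q] nz1 nz[of 4] nz[of 5] unfolding E by (simp add: mult_ac)
qed

text \<open>Everything is refined to moduli 10 and 20, where \<open>A i * M i = B (2 * i)\<close>
  and \<open>A i = B i * B (i + 10)\<close>; the rest is cancellation. Passing from q to -q turns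
  \<open>A\<close> into \<open>M\<close> exactly at the odd indices.\<close>

lemma RR_pair_products:
  assumes q: "norm q < 1"
  shows "RR_G q * RR_H (q ^ 4) * qpoch_inf (q ^ 2) (q ^ 2) = theta q (q ^ 9)"
    and "RR_H q * RR_G (q ^ 4) * qpoch_inf (q ^ 2) (q ^ 2) = theta (q ^ 3) (q ^ 7)"
    and "RR_G q * RR_G (-q) * qpoch_inf (q ^ 2) (q ^ 2) = theta (q ^ 4) (q ^ 6)"
    and "RR_H q * RR_H (-q) * qpoch_inf (q ^ 2) (q ^ 2) = theta (q ^ 2) (q ^ 8)"
proof -
  define A where "A = (\<lambda>i. qpoch_inf (q ^ i) (q ^ 10))"
  define M where "M = (\<lambda>i. qpoch_inf (- (q ^ i)) (q ^ 10))"
  define B where "B = (\<lambda>i. qpoch_inf (q ^ i) (q ^ 20))"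
  have qm: "norm (-q) < 1" and q4: "norm (q ^ 4) < 1" and q10: "norm (q ^ 10) < 1"
    using q by (auto intro: norm_power_lt_1)
  have s: "qpoch_inf (q ^ i) (q ^ 5) = A i * A (i + 5)" for i
    using qpoch_inf_split_power[OF q, of 5 1 i] by (simp add: A_def)
  have s1: "qpoch_inf q (q ^ 5) = A 1 * A 6" using s[of 1] by simp
  have sB: "A i = B i * B (i + 10)" for i
    using qpoch_inf_split_power[OF q, of 10 1 i] by (simp add: A_def B_def)
  have sM: "A i * M i = B (2 * i)" for i
    using qpoch_inf_square[OF q10, of "q ^ i"] by (simp add: A_def M_def B_def mult.commute flip: power_mult)
  have G: "RR_G q * (A 1 * A 6 * (A 4 * A 9)) = 1"
    using RR_G_product(1)[OF q] by (simp add: s s1)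
  have H: "RR_H q * (A 2 * A 7 * (A 3 * A 8)) = 1"
    using RR_G_product(2)[OF q] by (simp add: s s1)
  have G4: "RR_G (q ^ 4) * (B 4 * B 16) = 1"
    using RR_G_product(1)[OF q4] by (simp add: B_def flip: power_mult)
  have H4: "RR_H (q ^ 4) * (B 8 * B 12) = 1"
    using RR_G_product(2)[OF q4] by (simp add: B_def flip: power_mult)
  have e: "qpoch_inf ((-q) ^ i) ((-q) ^ 5) = qpoch_inf ((-q) ^ i) (q ^ 10) * qpoch_inf ((-q) ^ (i + 5)) (q ^ 10)" for i
    using qpoch_inf_split_power[OF qm, of 5 1 i] by simp
  have G': "RR_G (-q) * (M 1 * A 6 * (A 4 * M 9)) = 1"
    using RR_G_product(1)[OF qm] e[of 1] e[of 4] by (simp add: A_def M_def)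
  have H': "RR_H (-q) * (A 2 * M 7 * (M 3 * A 8)) = 1"
    using RR_G_product(2)[OF qm] e[of 2] e[of 3] by (simp add: A_def M_def)
  have E2: "qpoch_inf (q ^ 2) (q ^ 2) = A 2 * A 4 * A 6 * A 8 * A 10"
    using qpoch_inf_split[OF norm_power_lt_1[OF q, of 2], of 5 "q ^ 2"]
    by (simp add: A_def eval_nat_numeral flip: power_mult power_add) (simp add: mult_ac)
  have M: "theta (q ^ i) (q ^ j) = M i * M j * A 10" if "i + j = 10" "i > 0" "j > 0" for i j
    using theta_powers[OF q that(2,3), of 1 1] that by (simp add: A_def M_def)
  have A2: "A 2 = B 2 * B 12" and A4: "A 4 = B 4 * B 14" and A6: "A 6 = B 6 * B 16" and A8: "A 8 = B 8 * B 18"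
    using sB[of 2] sB[of 4] sB[of 6] sB[of 8] by simp_all
  have B: "B 2 = A 1 * M 1" "B 18 = A 9 * M 9" "B 6 = A 3 * M 3" "B 14 = A 7 * M 7"
    "B 8 = A 4 * M 4" "B 12 = A 6 * M 6" "B 4 = A 2 * M 2" "B 16 = A 8 * M 8"
    using sM[of 1] sM[of 9] sM[of 3] sM[of 7] sM[of 4] sM[of 6] sM[of 2] sM[of 8] by simp_all
  have "RR_G q * RR_H (q ^ 4) * qpoch_inf (q ^ 2) (q ^ 2) =
      (RR_G q * (A 1 * A 6 * (A 4 * A 9))) * (RR_H (q ^ 4) * (B 8 * B 12)) * (M 1 * M 9 * A 10)"
    unfolding E2 A2 A8 B(1,2) by (simp only: mult_ac)
  thus "RR_G q * RR_H (q ^ 4) * qpoch_inf (q ^ 2) (q ^ 2) = theta q (q ^ 9)"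
    unfolding G H4 using M[of 1 9] by simp
  have "RR_H q * RR_G (q ^ 4) * qpoch_inf (q ^ 2) (q ^ 2) =
      (RR_H q * (A 2 * A 7 * (A 3 * A 8))) * (RR_G (q ^ 4) * (B 4 * B 16)) * (M 3 * M 7 * A 10)"
    unfolding E2 A4 A6 B(3,4) by (simp only: mult_ac)
  thus "RR_H q * RR_G (q ^ 4) * qpoch_inf (q ^ 2) (q ^ 2) = theta (q ^ 3) (q ^ 7)"
    unfolding H G4 using M[of 3 7] by simp
  have "RR_G q * RR_G (-q) * qpoch_inf (q ^ 2) (q ^ 2) =
      (RR_G q * (A 1 * A 6 * (A 4 * A 9))) * (RR_G (-q) * (M 1 * A 6 * (A 4 * M 9))) * (M 4 * M 6 * A 10)"
    unfolding E2 A2 A8 B(1,2,5,6) by (simp only: mult_ac)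
  thus "RR_G q * RR_G (-q) * qpoch_inf (q ^ 2) (q ^ 2) = theta (q ^ 4) (q ^ 6)"
    unfolding G G' using M[of 4 6] by simp
  have "RR_H q * RR_H (-q) * qpoch_inf (q ^ 2) (q ^ 2) =
      (RR_H q * (A 2 * A 7 * (A 3 * A 8))) * (RR_H (-q) * (A 2 * M 7 * (M 3 * A 8))) * (M 2 * M 8 * A 10)"
    unfolding E2 A4 A6 B(3,4,7,8) by (simp only: mult_ac)
  thus "RR_H q * RR_H (-q) * qpoch_inf (q ^ 2) (q ^ 2) = theta (q ^ 2) (q ^ 8)"
    unfolding H H' using M[of 2 8] by simp
qed

section \<open>Ramanujan's functions phi and psi\<close>

lemma theta_diag:
  assumes "norm q < 1"
  shows "theta q q = kappa q ^ 2 * qpoch_inf (q ^ 2) (q ^ 2)"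
  using theta_powers[OF assms, of 1 1 1 1] by (simp add: kappa_def power2_eq_square)

text \<open>This is 2 psi(q); the 2 is the index-0 factor of
  \<open>qpoch_inf (-1) q\<close>.\<close>

lemma theta_one:
  assumes "norm q < 1"
  shows "theta 1 q = 2 * qpoch_inf (-q) q ^ 2 * qpoch_inf q q"
proof -
  have "qpoch_inf (-1) q = 2 * qpoch_inf (-q) q"
    using prodinf_split_head[OF qpoch_convergent[OF assms, of "-1"]] 
    unfolding qpoch_inf_def by (simp add: field_simps)
  thus ?thesis
    using jacobi_triple_product[of 1 q] assms by (simp add: power2_eq_square)
qed

text \<open>The origin of the reciprocal terms in the theorem: by Euler,
  \<open>qpoch_inf (-(q ^ 2)) (q ^ 2)\<close> is \<open>1 / kappa (-(q ^ 2))\<close>.\<close>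

lemma theta_one_square:
  assumes "norm q < 1"
  shows "theta 1 (q ^ 2) = 2 * (1 / kappa (-(q ^ 2)) ^ 2) * qpoch_inf (q ^ 2) (q ^ 2)"
proof -
  have q2: "norm (q ^ 2) < 1" using assms by (simp add: norm_power_lt_1)
  have "qpoch_inf (-(q ^ 2)) (q ^ 2) * kappa (-(q ^ 2)) = 1"
    using euler_odd_distinct[OF q2] by (simp add: kappa_def)
  hence "qpoch_inf (-(q ^ 2)) (q ^ 2) = 1 / kappa (-(q ^ 2))"
    by (metis mult_eq_0_iff nonzero_eq_divide_eq zero_neq_one)
  thus ?thesis using theta_one[OF q2] by (simp add: power_divide)
qed

text \<open>The Rogers-Ramanujan identities bring in (q;q) together with its value at q^4 or -q,
  whereas the final normalisation is by (q^2;q^2). The two conversions bridge this gap; both rest on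
  Euler's identity, the second also on
  \<open>kappa q * kappa (-q) = kappa (-(q ^ 2))\<close>.\<close>

lemma eta_theta_conversions:
  assumes q: "norm q < 1"
  shows "2 * qpoch_inf q q * qpoch_inf (q ^ 4) (q ^ 4) * theta q q =
      qpoch_inf (q ^ 2) (q ^ 2) * theta 1 q * theta (-(q ^ 2)) (-(q ^ 2))"
    and "2 * qpoch_inf q q * qpoch_inf (-q) (-q) * theta 1 (q ^ 2) =
      qpoch_inf (q ^ 2) (q ^ 2) * theta 1 q * theta 1 (-q)"
proof -
  have qm: "norm (-q) < 1" and q2: "norm (q ^ 2) < 1" and q2m: "norm (-(q ^ 2)) < 1"
    using q by (auto simp: norm_power power_less_one_iff)
  have s1: "qpoch_inf (-q) q = kappa q * qpoch_inf (-(q ^ 2)) (q ^ 2)"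
    using qpoch_inf_split2[OF q, of "-q"] by (simp add: kappa_def power2_eq_square)
  have s2: "qpoch_inf q (-q) = kappa (-q) * qpoch_inf (-(q ^ 2)) (q ^ 2)"
    using qpoch_inf_split2[OF qm, of q] by (simp add: kappa_def power2_eq_square)
  have e: "qpoch_inf (-(q ^ 2)) (q ^ 2) * kappa (-(q ^ 2)) = 1"
    using euler_odd_distinct[OF q2] by (simp add: kappa_def)
  have k: "kappa q * kappa (-q) = kappa (-(q ^ 2))"
    using qpoch_inf_square[OF q2, of q] by (simp add: kappa_def mult.commute)
  have 1: "qpoch_inf (-q) q * kappa (-(q ^ 2)) = kappa q"
    unfolding s1 using e by (simp add: mult.assoc)
  have "theta (-(q ^ 2)) (-(q ^ 2)) = kappa (-(q ^ 2)) ^ 2 * qpoch_inf (q ^ 4) (q ^ 4)"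
    using theta_diag[OF q2m] by simp
  thus "2 * qpoch_inf q q * qpoch_inf (q ^ 4) (q ^ 4) * theta q q =
      qpoch_inf (q ^ 2) (q ^ 2) * theta 1 q * theta (-(q ^ 2)) (-(q ^ 2))"
    unfolding theta_diag[OF q] theta_one[OF q] 1[symmetric] by (simp add: power_mult_distrib mult_ac)
  have "qpoch_inf (-q) q * qpoch_inf q (-q) = qpoch_inf (-(q ^ 2)) (q ^ 2) * (qpoch_inf (-(q ^ 2)) (q ^ 2) * (kappa q * kappa (-q)))"
    unfolding s1 s2 by (simp add: mult_ac)
  hence 2: "qpoch_inf (-(q ^ 2)) (q ^ 2) = qpoch_inf (-q) q * qpoch_inf q (-q)"
    unfolding k e by simp
  show "2 * qpoch_inf q q * qpoch_inf (-q) (-q) * theta 1 (q ^ 2) =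
      qpoch_inf (q ^ 2) (q ^ 2) * theta 1 q * theta 1 (-q)"
    unfolding theta_one[OF q] theta_one[OF q2] theta_one[OF qm] 2 by (simp add: power_mult_distrib mult_ac)
qed

text \<open>Euler's pentagonal number theorem; it lets the continuity of (q;q) in q be read off from
  that of theta.\<close>

lemma qpoch_inf_eq_theta:
  assumes "norm q < 1"
  shows "qpoch_inf q q = theta (-q) (-(q ^ 2))"
  using qpoch_inf_split[OF assms, of 3 q] theta_powers[OF assms, of 1 2 "-1" "-1"]
  by (simp add: eval_nat_numeral)

subsection \<open>Theta series of binary quadratic forms\<close>

text \<open>Unconditional summability in \<open>complex\<close> is absolute, which yields
  summability of the family of products.\<close>

lemma has_sum_mult:
  fixes f g :: "_ \<Rightarrow> complex"
  assumes f: "(f has_sum a) A" and g: "(g has_sum b) B"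
  shows "((\<lambda>(x, y). f x * g y) has_sum (a * b)) (A \<times> B)"
proof (rule has_sum_SigmaI)
  show "((\<lambda>y. case (x, y) of (x, y) \<Rightarrow> f x * g y) has_sum (f x * b)) B" for x
    using has_sum_cmult_right[OF g] by simp
  show "((\<lambda>x. f x * b) has_sum (a * b)) A"
    by (rule has_sum_cmult_left[OF f])
  have "(\<lambda>x. norm (f x)) summable_on A" "(\<lambda>x. norm (g x)) summable_on B"
    using has_sum_imp_summable[OF f] has_sum_imp_summable[OF g]
    by (simp_all add: summable_on_iff_abs_summable_on_complex)
  hence "(\<lambda>z. norm ((\<lambda>(x, y). f x * g y) z)) summable_on (A \<times> B)"
    by (subst Infinite_Sum.abs_summable_on_Sigma_iff)
       (auto simp: norm_mult infsum_cmult_right' abs_mult intro!: summable_on_cmult_right summable_on_cmult_left)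
  thus "(\<lambda>(x, y). f x * g y) summable_on (A \<times> B)"
    by (rule abs_summable_summable)
qed

text \<open>The common engine of all the lattice identities: \<open>u\<close>, \<open>v\<close> are
  coordinates that diagonalise the exponent \<open>e\<close>, and \<open>u'\<close>,
  \<open>v'\<close> invert them over the integers, so each use only leaves polynomial identities.
  The constants of norm 1 carry the signs, and \<open>i + j > 0\<close> permits a zero exponent as
  in \<open>theta 1 q\<close>. Nonnegativity of \<open>e\<close> is a consequence of
  \<open>ex\<close>.\<close>

lemma theta_pair_has_sum:
  fixes u v u' v' e :: "int \<Rightarrow> int \<Rightarrow> int" and i j k l c :: nat
    and \<sigma> :: "int \<Rightarrow> int \<Rightarrow> complex"
  assumes q: "norm q < 1" and pos: "i + j > 0" "k + l > 0"
    and nrm: "norm a = 1" "norm b = 1" "norm a' = 1" "norm b' = 1"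
    and inv: "\<And>s t. u' (u s t) (v s t) = s" "\<And>s t. v' (u s t) (v s t) = t"
      "\<And>n m. u (u' n m) (v' n m) = n" "\<And>n m. v (u' n m) (v' n m) = m"
    and ex: "\<And>s t. 2 * e s t = 2 * int c + int i * (u s t * (u s t + 1)) + int j * (u s t * (u s t - 1))
        + int k * (v s t * (v s t + 1)) + int l * (v s t * (v s t - 1))"
    and sg: "\<And>s t. \<sigma> s t = a ^ tri (u s t) * b ^ tri (- u s t) * (a' ^ tri (v s t) * b' ^ tri (- v s t))"
  shows "((\<lambda>(s, t). \<sigma> s t * q ^ nat (e s t)) has_sum
     q ^ c * (theta (a * q ^ i) (b * q ^ j) * theta (a' * q ^ k) (b' * q ^ l))) UNIV"
proof -
  have le: "norm q ^ n \<le> 1" for n using q by (intro power_le_one) auto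
  have sum: "(theta_term (a * q ^ i) (b * q ^ j) has_sum theta (a * q ^ i) (b * q ^ j)) UNIV"
    if "i + j > 0" "norm a = 1" "norm b = 1" for a b i j
  proof -
    have "norm q ^ i * norm q ^ j < 1"
      using q that unfolding power_add[symmetric] by (simp add: power_less_one_iff)
    thus ?thesis by (intro theta_has_sum) (use that le in \<open>auto simp: norm_mult norm_power\<close>)
  qed
  have "((\<lambda>x. q ^ c * (\<lambda>(n, m). theta_term (a * q ^ i) (b * q ^ j) n * theta_term (a' * q ^ k) (b' * q ^ l) m) x) has_sum
      q ^ c * (theta (a * q ^ i) (b * q ^ j) * theta (a' * q ^ k) (b' * q ^ l))) (UNIV \<times> UNIV)"
    by (intro has_sum_cmult_right has_sum_mult sum pos nrm)
  also have "?this \<longleftrightarrow> ?thesis"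
  proof (rule has_sum_reindex_bij_witness[symmetric, of _ "\<lambda>(n, m). (u' n m, v' n m)" "\<lambda>(s, t). (u s t, v s t)"])
    fix x :: "int \<times> int"
    obtain s t where x: "x = (s, t)" by fastforce
    define n m where nm: "n = u s t" "m = v s t"
    have "e s t = int (c + (i * tri n + j * tri (-n)) + (k * tri m + l * tri (-m)))"
    proof -
      have "2 * int (c + (i * tri n + j * tri (-n)) + (k * tri m + l * tri (-m))) =
          2 * int c + int i * (2 * int (tri n)) + int j * (2 * int (tri (-n))) + int k * (2 * int (tri m)) + int l * (2 * int (tri (-m)))"
        by simp
      also have "\<dots> = 2 * e s t"
        unfolding two_tri ex nm by (simp add: algebra_simps)
      finally show ?thesis by simp
    qed
    hence e: "nat (e s t) = c + (i * tri n + j * tri (-n)) + (k * tri m + l * tri (-m))"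
      by (simp only: nat_int)
    have "q ^ nat (e s t) = q ^ c * ((q ^ i) ^ tri n * (q ^ j) ^ tri (-n)) * ((q ^ k) ^ tri m * (q ^ l) ^ tri (-m))"
      unfolding e by (simp only: power_add power_mult)
    thus "q ^ c * (case (case x of (s, t) \<Rightarrow> (u s t, v s t)) of (n, m) \<Rightarrow> theta_term (a * q ^ i) (b * q ^ j) n * theta_term (a' * q ^ k) (b' * q ^ l) m)
        = (case x of (s, t) \<Rightarrow> \<sigma> s t * q ^ nat (e s t))"
      unfolding x prod.case sg nm[symmetric] by (simp add: theta_term_def power_mult_distrib mult_ac)
  qed (use inv in auto)
  finally show ?thesis .
qed

section \<open>Sorting lattice sums by residue classes\<close>

lemma has_sum_int_mod_split:
  fixes F :: "int \<times> int \<Rightarrow> complex" and m :: int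
  assumes "m > 0" and S: "\<And>k. k \<in> {0..<m} \<Longrightarrow> ((\<lambda>(j, t). F (m * j + k, t)) has_sum S k) UNIV"
  shows "(F has_sum (\<Sum>k\<in>{0..<m}. S k)) UNIV"
proof -
  have "(F has_sum S k) {x. fst x mod m = k}" if "k \<in> {0..<m}" for k
  proof -
    have "((\<lambda>(j, t). F (m * j + k, t)) has_sum S k) UNIV \<longleftrightarrow> (F has_sum S k) {x. fst x mod m = k}"
      using that assms(1)
      by (intro has_sum_reindex_bij_witness[of _ "\<lambda>(y, t). (y div m, t)" "\<lambda>(j, t). (m * j + k, t)"])
         (auto simp: case_prod_beta)
    thus ?thesis using S[OF that] by simp
  qed
  hence "(F has_sum (\<Sum>k\<in>{0..<m}. S k)) (\<Union>k\<in>{0..<m}. {x. fst x mod m = k})"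
    by (intro sum_has_sum) auto
  moreover have "(\<Union>k\<in>{0..<m}. {x :: int \<times> int. fst x mod m = k}) = UNIV"
    using assms(1) by auto
  ultimately show ?thesis by simp
qed

lemma has_sum_mod5:
  fixes F :: "int \<Rightarrow> int \<Rightarrow> complex"
  assumes "((\<lambda>(j, t). F (5 * j) t) has_sum S0) UNIV"
    "((\<lambda>(j, t). F (5 * j + 1) t) has_sum S1) UNIV"
    "((\<lambda>(j, t). F (5 * j + 2) t) has_sum S2) UNIV"
    "((\<lambda>(j, t). F (5 * j + 3) t) has_sum S3) UNIV"
    "((\<lambda>(j, t). F (5 * j + 4) t) has_sum S4) UNIV"
  shows "((\<lambda>(y, t). F y t) has_sum (S0 + S1 + S2 + S3 + S4)) UNIV"
proof -
  define S where "S = (\<lambda>k::int. if k = 0 then S0 else if k = 1 then S1 else if k = 2 then S2 else if k = 3 then S3 else S4)"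
  have set: "{0..<5::int} = {0,1,2,3,4}" by auto
  have "((\<lambda>(y, t). F y t) has_sum (\<Sum>k\<in>{0..<5}. S k)) UNIV"
    by (rule has_sum_int_mod_split) (use assms in \<open>auto simp: set S_def\<close>)
  thus ?thesis unfolding set by (simp add: S_def add_ac)
qed

lemma has_sum_mod2:
  fixes F :: "int \<Rightarrow> int \<Rightarrow> complex"
  assumes "((\<lambda>(j, t). F (2 * j) t) has_sum S0) UNIV"
    "((\<lambda>(j, t). F (2 * j + 1) t) has_sum S1) UNIV"
  shows "((\<lambda>(y, t). F y t) has_sum (S0 + S1)) UNIV"
proof -
  have set: "{0..<2::int} = {0,1}" by auto
  have "((\<lambda>(y, t). F y t) has_sum (\<Sum>k\<in>{0..<2::int}. if k = 0 then S0 else S1)) UNIV"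
    by (rule has_sum_int_mod_split) (use assms in \<open>auto simp: set\<close>)
  thus ?thesis unfolding set by simp
qed

text \<open>Half the sum and half the difference of a series and its twist by (-1)^w isolate the
  even and the odd rows.\<close>

lemma has_sum_parity_part:
  fixes F :: "int \<Rightarrow> int \<Rightarrow> complex"
  assumes S: "((\<lambda>(w, t). F w t) has_sum S) UNIV"
    and T: "((\<lambda>(w, t). (if even w then 1 else -1) * F w t) has_sum T) UNIV"
  shows "((\<lambda>(j, t). F (2 * j) t) has_sum ((S + T) / 2)) UNIV"
    and "((\<lambda>(j, t). F (2 * j + 1) t) has_sum ((S - T) / 2)) UNIV"
proof -
  let ?F = "\<lambda>(w, t). F w t" and ?G = "\<lambda>(w, t). (if even w then 1 else -1) * F w t"
  have "((\<lambda>x. (?F x + ?G x) / 2) has_sum ((S + T) / 2)) UNIV"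
    by (intro has_sum_divide_const has_sum_add S T)
  also have "?this \<longleftrightarrow> (?F has_sum ((S + T) / 2)) {x. even (fst x)}"
    by (rule has_sum_cong_neutral) auto
  also have "\<dots> \<longleftrightarrow> ((\<lambda>(j, t). F (2 * j) t) has_sum ((S + T) / 2)) UNIV"
    by (rule has_sum_reindex_bij_witness[of _ "\<lambda>(j, t). (2 * j, t)" "\<lambda>(y, t). (y div 2, t)"]) auto
  finally show "((\<lambda>(j, t). F (2 * j) t) has_sum ((S + T) / 2)) UNIV" .
  have "((\<lambda>x. (?F x + - ?G x) / 2) has_sum ((S + - T) / 2)) UNIV"
    by (intro has_sum_divide_const has_sum_add has_sum_uminusI S T)
  also have "?this \<longleftrightarrow> (?F has_sum ((S + - T) / 2)) {x. odd (fst x)}"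
    by (rule has_sum_cong_neutral) auto
  also have "\<dots> \<longleftrightarrow> ((\<lambda>(j, t). F (2 * j + 1) t) has_sum ((S + - T) / 2)) UNIV"
    by (rule has_sum_reindex_bij_witness[of _ "\<lambda>(j, t). (2 * j + 1, t)" "\<lambda>(y, t). (y div 2, t)"]) auto
  finally show "((\<lambda>(j, t). F (2 * j + 1) t) has_sum ((S - T) / 2)) UNIV" by simp
qed

section \<open>Signs, and the series sorted by parity\<close>

lemma tri_mult_2: "int (tri n) * 2 = n * (n + 1)"
  using two_tri[of n] by simp

lemma minus_one_power_tri: "(-1::complex) ^ tri n * (-1) ^ tri (-n) = (if even n then 1 else -1)"
proof -
  have "int (tri n + tri (-n)) = n * n"
    using two_tri[of n] two_tri[of "-n"] by (simp add: algebra_simps)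
  hence "even (tri n + tri (-n)) \<longleftrightarrow> even n"
    by (metis even_mult_iff even_of_nat)
  thus ?thesis by (simp flip: power_add)
qed

text \<open>Needed for thetas with a minus sign in one argument only, where the sign is (-1) to the
  power \<open>tri\<close> and not simply the parity of the index.\<close>

lemma minus_one_power_tri_shift:
  "(-1::complex) ^ tri (t - 2 * s) = (-1) ^ tri t * (if even s then 1 else -1)"
  "(-1::complex) ^ tri (1 + 2 * s - t) = - ((-1) ^ tri t * (if even s then 1 else -1))"
proof -
  have e: "even (tri a) \<longleftrightarrow> (even (tri b) \<longleftrightarrow> even c)" if "int (tri a) = int (tri b) + c + 2 * d" for a b c d
    using that by (metis dvd_triv_left even_add even_of_nat)
  have "int (tri (t - 2 * s)) = int (tri t) + s + 2 * (s * s - t * s - s)"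
    using two_tri[of "t - 2 * s"] two_tri[of t] by (simp add: algebra_simps)
  from e[OF this] show "(-1::complex) ^ tri (t - 2 * s) = (-1) ^ tri t * (if even s then 1 else -1)"
    by (auto simp: minus_one_power_iff)
  have "int (tri (1 + 2 * s - t)) = int (tri t) + (s + 1) + 2 * (s * s - t * s + s - t)"
    using two_tri[of "1 + 2 * s - t"] two_tri[of t] by (simp add: algebra_simps)
  from e[OF this] show "(-1::complex) ^ tri (1 + 2 * s - t) = - ((-1) ^ tri t * (if even s then 1 else -1))"
    by (auto simp: minus_one_power_iff)
qed

lemma theta_minus_one:
  assumes "norm q < 1"
  shows "theta (-q) (-1) = 0"
proof -
  have "qpoch_inf 1 q = 0"
  proof -
    have "\<not> (\<forall>k. 1 - 1 * q ^ k \<noteq> 0)" by (auto intro!: exI[of _ 0])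
    thus ?thesis unfolding qpoch_inf_def
      using has_prod_eq_0_iff[OF convergent_prod_has_prod[OF qpoch_convergent[OF assms, of 1]]] by auto
  qed
  thus ?thesis using jacobi_triple_product[of "-q" "-1"] assms by simp
qed

text \<open>With n = w + t and m = t the twist is (-1)^n (-1)^m, so it merely flips the signs of the
  theta arguments. The constant 5 = (1 + 19)/4 arises from (n + 1/2)^2 + 19 (m + 1/2)^2; that series
  has twist 0, so its even and odd rows are equal.\<close>

lemma parity_twisted_sums:
  assumes q: "norm q < 1"
  shows "((\<lambda>(w, t). q ^ nat ((w + t) * (w + t) + 19 * t * t)) has_sum
      (theta q q * theta (q ^ 19) (q ^ 19))) UNIV"
    and "((\<lambda>(w, t). (if even w then 1 else -1) * q ^ nat ((w + t) * (w + t) + 19 * t * t)) has_sum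
      (theta (-q) (-q) * theta (-(q ^ 19)) (-(q ^ 19)))) UNIV"
    and "((\<lambda>(w, t). q ^ nat (5 + (w + t) * (w + t + 1) + 19 * t * (t + 1))) has_sum
      (q ^ 5 * (theta 1 (q ^ 2) * theta 1 (q ^ 38)))) UNIV"
    and "((\<lambda>(w, t). (if even w then 1 else -1) * q ^ nat (5 + (w + t) * (w + t + 1) + 19 * t * (t + 1))) has_sum 0) UNIV"
proof -
  have u: "((\<lambda>(w, t). 1 * q ^ nat ((w + t) * (w + t) + 19 * t * t)) has_sum
     (q ^ 0 * (theta (1 * q ^ 1) (1 * q ^ 1) * theta (1 * q ^ 19) (1 * q ^ 19)))) UNIV"
    by (rule theta_pair_has_sum[where u = "\<lambda>s t. s + t" and v = "\<lambda>s t. t"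
          and u' = "\<lambda>n m. n - m" and v' = "\<lambda>n m. m", OF q];
        simp add: algebra_simps)
  have v: "((\<lambda>(w, t). (if even w then 1 else -1) * q ^ nat ((w + t) * (w + t) + 19 * t * t)) has_sum
     (q ^ 0 * (theta ((-1) * q ^ 1) ((-1) * q ^ 1) * theta ((-1) * q ^ 19) ((-1) * q ^ 19)))) UNIV"
    by (rule theta_pair_has_sum[where u = "\<lambda>s t. s + t" and v = "\<lambda>s t. t"
          and u' = "\<lambda>n m. n - m" and v' = "\<lambda>n m. m", OF q];
        (simp only: minus_one_power_tri; auto; fail)?; simp add: algebra_simps two_tri tri_mult_2)
  have r: "((\<lambda>(w, t). 1 * q ^ nat (5 + (w + t) * (w + t + 1) + 19 * t * (t + 1))) has_sum
     (q ^ 5 * (theta (1 * q ^ 2) (1 * q ^ 0) * theta (1 * q ^ 38) (1 * q ^ 0)))) UNIV"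
    by (rule theta_pair_has_sum[where u = "\<lambda>s t. s + t" and v = "\<lambda>s t. t"
          and u' = "\<lambda>n m. n - m" and v' = "\<lambda>n m. m", OF q];
        simp add: algebra_simps)
  have z: "((\<lambda>(w, t). (if even w then 1 else -1) * q ^ nat (5 + (w + t) * (w + t + 1) + 19 * t * (t + 1))) has_sum
     (q ^ 5 * (theta ((-1) * q ^ 2) ((-1) * q ^ 0) * theta ((-1) * q ^ 38) ((-1) * q ^ 0)))) UNIV"
    by (rule theta_pair_has_sum[where u = "\<lambda>s t. s + t" and v = "\<lambda>s t. t"
          and u' = "\<lambda>n m. n - m" and v' = "\<lambda>n m. m", OF q];
        (simp only: minus_one_power_tri; auto; fail)?; simp add: algebra_simps two_tri tri_mult_2)
  have zero: "theta (-(q ^ 2)) (-1) = 0"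
    using q by (intro theta_minus_one norm_power_lt_1) auto
  show "((\<lambda>(w, t). q ^ nat ((w + t) * (w + t) + 19 * t * t)) has_sum
      (theta q q * theta (q ^ 19) (q ^ 19))) UNIV"
    using u by simp
  show "((\<lambda>(w, t). (if even w then 1 else -1) * q ^ nat ((w + t) * (w + t) + 19 * t * t)) has_sum
      (theta (-q) (-q) * theta (-(q ^ 19)) (-(q ^ 19)))) UNIV"
    using v by simp
  show "((\<lambda>(w, t). q ^ nat (5 + (w + t) * (w + t + 1) + 19 * t * (t + 1))) has_sum
      (q ^ 5 * (theta 1 (q ^ 2) * theta 1 (q ^ 38)))) UNIV"
    using r by (simp add: theta_commute[of 1])
  show "((\<lambda>(w, t). (if even w then 1 else -1) * q ^ nat (5 + (w + t) * (w + t + 1) + 19 * t * (t + 1))) has_sum 0) UNIV"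
    using z by (simp add: zero)
qed

text \<open>Both sides are twice the theta series of the form $4y^2 + 2ty + 5t^2$, with $y$ sorted
  modulo $5$ on the left and $t$ modulo $2$ on the right.\<close>

lemma theta_form_4_2_5:
  assumes q: "norm q < 1"
  shows "2 * theta (q ^ 5) (q ^ 5) * theta (q ^ 95) (q ^ 95) + 4 * q ^ 4 * theta (q ^ 3) (q ^ 7) * theta (q ^ 57) (q ^ 133)
     + 4 * q ^ 16 * theta q (q ^ 9) * theta (q ^ 19) (q ^ 171) =
     theta q q * theta (q ^ 19) (q ^ 19) + theta (-q) (-q) * theta (-(q ^ 19)) (-(q ^ 19))
      + q ^ 5 * theta 1 (q ^ 2) * theta 1 (q ^ 38)"
proof -
  have lhs: "((\<lambda>(y, t). 1 * q ^ nat (4 * y * y + 2 * t * y + 5 * t * t)) has_sum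
     ((q ^ 0 * (theta (1 * q ^ 5) (1 * q ^ 5) * theta (1 * q ^ 95) (1 * q ^ 95))) +
      (q ^ 4 * (theta (1 * q ^ 7) (1 * q ^ 3) * theta (1 * q ^ 133) (1 * q ^ 57))) +
      (q ^ 16 * (theta (1 * q ^ 9) (1 * q ^ 1) * theta (1 * q ^ 171) (1 * q ^ 19))) +
      (q ^ 16 * (theta (1 * q ^ 9) (1 * q ^ 1) * theta (1 * q ^ 171) (1 * q ^ 19))) +
      (q ^ 4 * (theta (1 * q ^ 7) (1 * q ^ 3) * theta (1 * q ^ 133) (1 * q ^ 57))))) UNIV"
  \<comment> \<open>At y = 5s + k, with n = s + t, the form is 5n^2 + 2kn + 95s^2 + 38ks + 4k^2,
    without a cross term.\<close>
  proof (rule has_sum_mod5, goal_cases)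
    case 1
    show ?case
      by (rule theta_pair_has_sum[where u = "\<lambda>s t. s + t" and v = "\<lambda>s t. s"
          and u' = "\<lambda>n m. m" and v' = "\<lambda>n m. n - m", OF q];
        simp add: algebra_simps)
  next
    case 2
    show ?case
      by (rule theta_pair_has_sum[where u = "\<lambda>s t. s + t" and v = "\<lambda>s t. s"
          and u' = "\<lambda>n m. m" and v' = "\<lambda>n m. n - m", OF q];
        simp add: algebra_simps)
  next
    case 3
    show ?case
      by (rule theta_pair_has_sum[where u = "\<lambda>s t. s + t" and v = "\<lambda>s t. s"
          and u' = "\<lambda>n m. m" and v' = "\<lambda>n m. n - m", OF q];
        simp add: algebra_simps)
  next
    \<comment> \<open>Classes 3 and 4 are -2 and -1: replacing both coordinates x by -1 - x turns
      them into classes 2 and 1.\<close>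
    case 4
    show ?case
      by (rule theta_pair_has_sum[where u = "\<lambda>s t. - 1 - s - t" and v = "\<lambda>s t. - 1 - s"
          and u' = "\<lambda>n m. - 1 - m" and v' = "\<lambda>n m. m - n", OF q];
        simp add: algebra_simps)
  next
    case 5
    show ?case
      by (rule theta_pair_has_sum[where u = "\<lambda>s t. - 1 - s - t" and v = "\<lambda>s t. - 1 - s"
          and u' = "\<lambda>n m. - 1 - m" and v' = "\<lambda>n m. m - n", OF q];
        simp add: algebra_simps)
  qed
  have "((\<lambda>(t, y). q ^ nat (4 * y * y + 2 * t * y + 5 * t * t)) has_sum
      ((theta q q * theta (q ^ 19) (q ^ 19) + theta (-q) (-q) * theta (-(q ^ 19)) (-(q ^ 19))) / 2 +
       (q ^ 5 * (theta 1 (q ^ 2) * theta 1 (q ^ 38)) + 0) / 2)) UNIV"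
  \<comment> \<open>Replacing t by 2t gives (2y + t)^2 + 19t^2, and by 2t + 1 gives (2y + t)(2y + t
    + 1) + 19t(t + 1) + 5: in both cases the rows with w = 2y even.\<close>
  proof (rule has_sum_mod2, goal_cases)
    case 1
    have "((\<lambda>(t, y). q ^ nat (4 * y * y + 2 * (2 * t) * y + 5 * (2 * t) * (2 * t))) has_sum S) UNIV \<longleftrightarrow>
        ((\<lambda>(j, t). q ^ nat ((2 * j + t) * (2 * j + t) + 19 * t * t)) has_sum S) UNIV" for S
      by (rule has_sum_reindex_bij_witness[of _ prod.swap prod.swap]) (auto simp: algebra_simps)
    with has_sum_parity_part(1)[OF parity_twisted_sums(1,2)[OF q]] show ?case by simp
  next
    case 2
    have "((\<lambda>(t, y). q ^ nat (4 * y * y + 2 * (2 * t + 1) * y + 5 * (2 * t + 1) * (2 * t + 1))) has_sum S) UNIV \<longleftrightarrow>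
        ((\<lambda>(j, t). q ^ nat (5 + (2 * j + t) * (2 * j + t + 1) + 19 * t * (t + 1))) has_sum S) UNIV" for S
      by (rule has_sum_reindex_bij_witness[of _ prod.swap prod.swap]) (auto simp: algebra_simps)
    with has_sum_parity_part(1)[OF parity_twisted_sums(3,4)[OF q]] show ?case by simp
  qed
  hence "((\<lambda>(y, t). 1 * q ^ nat (4 * y * y + 2 * t * y + 5 * t * t)) has_sum
      ((theta q q * theta (q ^ 19) (q ^ 19) + theta (-q) (-q) * theta (-(q ^ 19)) (-(q ^ 19))) / 2 +
       (q ^ 5 * (theta 1 (q ^ 2) * theta 1 (q ^ 38)) + 0) / 2)) UNIV"
    by (subst has_sum_reindex_bij_witness[of _ prod.swap prod.swap UNIV]) auto
  from has_sum_unique[OF lhs this] show ?thesis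
    by (simp add: field_simps theta_commute[of "q ^ 7"] theta_commute[of "q ^ 9"] theta_commute[of "q ^ 133"] theta_commute[of "q ^ 171"])
qed

text \<open>Here both sides are twice the theta series of $y^2 + ty + 5t^2$ restricted to odd $y$.\<close>

lemma theta_form_1_1_5:
  assumes q: "norm q < 1"
  shows "4 * q * theta (q ^ 4) (q ^ 6) * theta (q ^ 76) (q ^ 114) + 4 * q ^ 9 * theta (q ^ 2) (q ^ 8) * theta (q ^ 38) (q ^ 152)
     + 2 * q ^ 25 * theta 1 (q ^ 10) * theta 1 (q ^ 190) =
     theta q q * theta (q ^ 19) (q ^ 19) - theta (-q) (-q) * theta (-(q ^ 19)) (-(q ^ 19))
      + q ^ 5 * theta 1 (q ^ 2) * theta 1 (q ^ 38)"
proof -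
  have lhs: "((\<lambda>(y, t). 1 * q ^ nat ((2 * y + 1) * (2 * y + 1) + t * (2 * y + 1) + 5 * t * t)) has_sum
     ((q ^ 1 * (theta (1 * q ^ 6) (1 * q ^ 4) * theta (1 * q ^ 114) (1 * q ^ 76))) +
      (q ^ 9 * (theta (1 * q ^ 8) (1 * q ^ 2) * theta (1 * q ^ 152) (1 * q ^ 38))) +
      (q ^ 25 * (theta (1 * q ^ 10) (1 * q ^ 0) * theta (1 * q ^ 190) (1 * q ^ 0))) +
      (q ^ 9 * (theta (1 * q ^ 8) (1 * q ^ 2) * theta (1 * q ^ 152) (1 * q ^ 38))) +
      (q ^ 1 * (theta (1 * q ^ 6) (1 * q ^ 4) * theta (1 * q ^ 114) (1 * q ^ 76))))) UNIV"
  \<comment> \<open>With Y = 2y + 1 = 10s + 2k + 1 the constant is (2k + 1)^2. The class k = 2,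
    where 5 divides Y, produces q^25 and the thetas with an argument 1.\<close>
  proof (rule has_sum_mod5, goal_cases)
    case 1
    show ?case
      by (rule theta_pair_has_sum[where u = "\<lambda>s t. s + t" and v = "\<lambda>s t. s"
          and u' = "\<lambda>n m. m" and v' = "\<lambda>n m. n - m", OF q];
        simp add: algebra_simps)
  next
    case 2
    show ?case
      by (rule theta_pair_has_sum[where u = "\<lambda>s t. s + t" and v = "\<lambda>s t. s"
          and u' = "\<lambda>n m. m" and v' = "\<lambda>n m. n - m", OF q];
        simp add: algebra_simps)
  next
    case 3
    show ?case
      by (rule theta_pair_has_sum[where u = "\<lambda>s t. s + t" and v = "\<lambda>s t. s"
          and u' = "\<lambda>n m. m" and v' = "\<lambda>n m. n - m", OF q];
        simp add: algebra_simps)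
  next
    case 4
    show ?case
      by (rule theta_pair_has_sum[where u = "\<lambda>s t. - 1 - s - t" and v = "\<lambda>s t. - 1 - s"
          and u' = "\<lambda>n m. - 1 - m" and v' = "\<lambda>n m. m - n", OF q];
        simp add: algebra_simps)
  next
    case 5
    show ?case
      by (rule theta_pair_has_sum[where u = "\<lambda>s t. - 1 - s - t" and v = "\<lambda>s t. - 1 - s"
          and u' = "\<lambda>n m. - 1 - m" and v' = "\<lambda>n m. m - n", OF q];
        simp add: algebra_simps)
  qed
  have "((\<lambda>(t, y). q ^ nat ((2 * y + 1) * (2 * y + 1) + t * (2 * y + 1) + 5 * t * t)) has_sum
      ((theta q q * theta (q ^ 19) (q ^ 19) - theta (-q) (-q) * theta (-(q ^ 19)) (-(q ^ 19))) / 2 +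
       (q ^ 5 * (theta 1 (q ^ 2) * theta 1 (q ^ 38)) - 0) / 2)) UNIV"
  \<comment> \<open>Now w = 2y + 1 is odd, which accounts for the minus sign between the two
    products of phi.\<close>
  proof (rule has_sum_mod2, goal_cases)
    case 1
    have "((\<lambda>(t, y). q ^ nat ((2 * y + 1) * (2 * y + 1) + 2 * t * (2 * y + 1) + 5 * (2 * t) * (2 * t))) has_sum S) UNIV \<longleftrightarrow>
        ((\<lambda>(j, t). q ^ nat ((2 * j + 1 + t) * (2 * j + 1 + t) + 19 * t * t)) has_sum S) UNIV" for S
      by (rule has_sum_reindex_bij_witness[of _ prod.swap prod.swap]) (auto simp: algebra_simps)
    with has_sum_parity_part(2)[OF parity_twisted_sums(1,2)[OF q]] show ?case by simp
  next
    case 2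
    have "((\<lambda>(t, y). q ^ nat ((2 * y + 1) * (2 * y + 1) + (2 * t + 1) * (2 * y + 1) + 5 * (2 * t + 1) * (2 * t + 1))) has_sum S) UNIV \<longleftrightarrow>
        ((\<lambda>(j, t). q ^ nat (5 + (2 * j + 1 + t) * (2 * j + 1 + t + 1) + 19 * t * (t + 1))) has_sum S) UNIV" for S
      by (rule has_sum_reindex_bij_witness[of _ prod.swap prod.swap]) (auto simp: algebra_simps)
    with has_sum_parity_part(2)[OF parity_twisted_sums(3,4)[OF q]] show ?case by simp
  qed
  hence "((\<lambda>(y, t). 1 * q ^ nat ((2 * y + 1) * (2 * y + 1) + t * (2 * y + 1) + 5 * t * t)) has_sum
      ((theta q q * theta (q ^ 19) (q ^ 19) - theta (-q) (-q) * theta (-(q ^ 19)) (-(q ^ 19))) / 2 +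
       (q ^ 5 * (theta 1 (q ^ 2) * theta 1 (q ^ 38)) - 0) / 2)) UNIV"
    by (subst has_sum_reindex_bij_witness[of _ prod.swap prod.swap UNIV]) auto
  from has_sum_unique[OF lhs this] show ?thesis
    by (simp add: field_simps theta_commute[of "q ^ 6"] theta_commute[of "q ^ 8"] theta_commute[of "q ^ 114"] theta_commute[of "q ^ 152"]
      theta_commute[of 1])
qed

text \<open>Sums of two squares n^2 + m^2 are sorted by n - 2m modulo 5. Class 0 is the square
  lattice scaled by the square root of 5; the other four classes contribute equally.\<close>

lemma phi_square_identity:
  assumes q: "norm q < 1"
  shows "theta q q ^ 2 - theta (q ^ 5) (q ^ 5) ^ 2 = 4 * q * theta q (q ^ 9) * theta (q ^ 3) (q ^ 7)"
proof -
  have rhs: "((\<lambda>(y, t). 1 * q ^ nat (y * y + 4 * t * y + 5 * t * t)) has_sum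
     ((q ^ 0 * (theta (1 * q ^ 5) (1 * q ^ 5) * theta (1 * q ^ 5) (1 * q ^ 5))) +
      (q ^ 1 * (theta (1 * q ^ 9) (1 * q ^ 1) * theta (1 * q ^ 7) (1 * q ^ 3))) +
      (q ^ 1 * (theta (1 * q ^ 7) (1 * q ^ 3) * theta (1 * q ^ 9) (1 * q ^ 1))) +
      (q ^ 1 * (theta (1 * q ^ 7) (1 * q ^ 3) * theta (1 * q ^ 9) (1 * q ^ 1))) +
      (q ^ 1 * (theta (1 * q ^ 9) (1 * q ^ 1) * theta (1 * q ^ 7) (1 * q ^ 3))))) UNIV"
  proof (rule has_sum_mod5, goal_cases)
    case 1
    show ?case
      by (rule theta_pair_has_sum[where u = "\<lambda>s t. 2 * s + t" and v = "\<lambda>s t. s"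
          and u' = "\<lambda>n m. m" and v' = "\<lambda>n m. n - 2 * m", OF q];
        simp add: algebra_simps)
  next
    case 2
    show ?case
      by (rule theta_pair_has_sum[where u = "\<lambda>s t. 2 * s + t" and v = "\<lambda>s t. s"
          and u' = "\<lambda>n m. m" and v' = "\<lambda>n m. n - 2 * m", OF q];
        simp add: algebra_simps)
  next
    \<comment> \<open>The linear coefficient 4k of the first coordinate is 8, 12, 16 in the last
      three classes; the substitutions -1 - n, n + 1, -2 - n lower it to 2, 2, 4.\<close>
    case 3
    show ?case
      by (rule theta_pair_has_sum[where u = "\<lambda>s t. - 1 - 2 * s - t" and v = "\<lambda>s t. s"
          and u' = "\<lambda>n m. m" and v' = "\<lambda>n m. - 1 - n - 2 * m", OF q];
        simp add: algebra_simps)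
  next
    case 4
    show ?case
      by (rule theta_pair_has_sum[where u = "\<lambda>s t. 1 + 2 * s + t" and v = "\<lambda>s t. - 1 - s"
          and u' = "\<lambda>n m. - 1 - m" and v' = "\<lambda>n m. n + 2 * m + 1", OF q];
        simp add: algebra_simps)
  next
    case 5
    show ?case
      by (rule theta_pair_has_sum[where u = "\<lambda>s t. - 2 - 2 * s - t" and v = "\<lambda>s t. - 1 - s"
          and u' = "\<lambda>n m. - 1 - m" and v' = "\<lambda>n m. - n + 2 * m", OF q];
        simp add: algebra_simps)
  qed
  have lhs: "((\<lambda>(y, t). 1 * q ^ nat (y * y + 4 * t * y + 5 * t * t)) has_sum
     (q ^ 0 * (theta (1 * q ^ 1) (1 * q ^ 1) * theta (1 * q ^ 1) (1 * q ^ 1)))) UNIV"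
    by (rule theta_pair_has_sum[where u = "\<lambda>s t. s + 2 * t" and v = "\<lambda>s t. t"
          and u' = "\<lambda>n m. n - 2 * m" and v' = "\<lambda>n m. m", OF q];
        simp add: algebra_simps)
  from has_sum_unique[OF lhs rhs] show ?thesis
    by (simp add: power2_eq_square theta_commute[of "q ^ 7"] theta_commute[of "q ^ 9"])
qed

text \<open>The same dissection centred at half-integers: y + 1/2 = (n + 1/2) + 2(m + 1/2), so the
  distinguished class is y = 2 modulo 5, the one fixed by y to -1 - y.\<close>

lemma psi_square_identity:
  assumes q: "norm q < 1"
  shows "theta 1 (q ^ 2) ^ 2 - (q * theta 1 (q ^ 10)) ^ 2 = 4 * theta (q ^ 4) (q ^ 6) * theta (q ^ 2) (q ^ 8)"
proof -
  have rhs: "((\<lambda>(y, t). 1 * q ^ nat ((y - 1 - 2 * t) * (y - 2 * t) + t * (t + 1))) has_sum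
     ((q ^ 0 * (theta (1 * q ^ 2) (1 * q ^ 8) * theta (1 * q ^ 6) (1 * q ^ 4))) +
      (q ^ 0 * (theta (1 * q ^ 6) (1 * q ^ 4) * theta (1 * q ^ 8) (1 * q ^ 2))) +
      (q ^ 2 * (theta (1 * q ^ 10) (1 * q ^ 0) * theta (1 * q ^ 10) (1 * q ^ 0))) +
      (q ^ 0 * (theta (1 * q ^ 6) (1 * q ^ 4) * theta (1 * q ^ 8) (1 * q ^ 2))) +
      (q ^ 0 * (theta (1 * q ^ 8) (1 * q ^ 2) * theta (1 * q ^ 6) (1 * q ^ 4))))) UNIV"
  proof (rule has_sum_mod5, goal_cases)
    case 1
    show ?case
      by (rule theta_pair_has_sum[where u = "\<lambda>s t. 2 * s - t" and v = "\<lambda>s t. s"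
          and u' = "\<lambda>n m. m" and v' = "\<lambda>n m. 2 * m - n", OF q];
        simp add: algebra_simps)
  next
    case 2
    show ?case
      by (rule theta_pair_has_sum[where u = "\<lambda>s t. 2 * s - t" and v = "\<lambda>s t. s"
          and u' = "\<lambda>n m. m" and v' = "\<lambda>n m. 2 * m - n", OF q];
        simp add: algebra_simps)
  next
    case 3
    show ?case
      by (rule theta_pair_has_sum[where u = "\<lambda>s t. 2 * s - t" and v = "\<lambda>s t. s"
          and u' = "\<lambda>n m. m" and v' = "\<lambda>n m. 2 * m - n", OF q];
        simp add: algebra_simps)
  next
    case 4
    show ?case
      by (rule theta_pair_has_sum[where u = "\<lambda>s t. - 1 - 2 * s + t" and v = "\<lambda>s t. - 1 - s"
          and u' = "\<lambda>n m. - 1 - m" and v' = "\<lambda>n m. n - 1 - 2 * m", OF q];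
        simp add: algebra_simps)
  next
    case 5
    show ?case
      by (rule theta_pair_has_sum[where u = "\<lambda>s t. 2 * s - t + 1" and v = "\<lambda>s t. - 1 - s"
          and u' = "\<lambda>n m. - 1 - m" and v' = "\<lambda>n m. - 1 - 2 * m - n", OF q];
        simp add: algebra_simps)
  qed
  have lhs: "((\<lambda>(y, t). 1 * q ^ nat ((y - 1 - 2 * t) * (y - 2 * t) + t * (t + 1))) has_sum
     (q ^ 0 * (theta (1 * q ^ 2) (1 * q ^ 0) * theta (1 * q ^ 2) (1 * q ^ 0)))) UNIV"
    by (rule theta_pair_has_sum[where u = "\<lambda>s t. s - 1 - 2 * t" and v = "\<lambda>s t. t"
          and u' = "\<lambda>n m. n + 1 + 2 * m" and v' = "\<lambda>n m. m", OF q];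
        simp add: algebra_simps)
  from has_sum_unique[OF lhs rhs] show ?thesis
    by (simp add: power2_eq_square theta_commute[of "q ^ 6"] theta_commute[of "q ^ 8"] theta_commute[of 1])
qed

text \<open>In these two, the summands are the classes of $y$ modulo $5$, and the class $y \equiv 2$
  contributes $0$ because of \<^term>\<open>theta (-x) (-1) = 0\<close>.\<close>

lemma theta_quintic_sum_1:
  assumes q: "norm q < 1"
  shows "2 * (theta (-(q ^ 2)) (-(q ^ 3)) * theta (-(q ^ 8)) (-(q ^ 12)) + q * theta (-q) (-(q ^ 4)) * theta (-(q ^ 4)) (-(q ^ 16)))
    = theta 1 q * theta (-(q ^ 2)) (-(q ^ 2))"
proof -
  have rhs: "((\<lambda>(y, t). (if even t then 1 else -1) * q ^ nat (int (tri (y - t)) + 2 * t * t)) has_sum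
     ((q ^ 0 * (theta ((-1) * q ^ 3) ((-1) * q ^ 2) * theta ((-1) * q ^ 12) ((-1) * q ^ 8))) +
      (q ^ 1 * (theta ((-1) * q ^ 4) ((-1) * q ^ 1) * theta ((-1) * q ^ 16) ((-1) * q ^ 4))) +
      (q ^ 3 * (theta ((-1) * q ^ 5) ((-1) * q ^ 0) * theta ((-1) * q ^ 20) ((-1) * q ^ 0))) +
      (q ^ 1 * (theta ((-1) * q ^ 4) ((-1) * q ^ 1) * theta ((-1) * q ^ 16) ((-1) * q ^ 4))) +
      (q ^ 0 * (theta ((-1) * q ^ 3) ((-1) * q ^ 2) * theta ((-1) * q ^ 12) ((-1) * q ^ 8))))) UNIV"
  \<comment> \<open>Writing y = 5s + k and t = s - u removes the cross term, and (-1)^t = (-1)^u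
    (-1)^s.\<close>
  proof (rule has_sum_mod5, goal_cases)
    case 1
    show ?case
      by (rule theta_pair_has_sum[where u = "\<lambda>s t. s - t" and v = "\<lambda>s t. s"
          and u' = "\<lambda>n m. m" and v' = "\<lambda>n m. m - n", OF q];
        (simp only: minus_one_power_tri; auto; fail)?; simp add: algebra_simps two_tri tri_mult_2)
  next
    case 2
    show ?case
      by (rule theta_pair_has_sum[where u = "\<lambda>s t. s - t" and v = "\<lambda>s t. s"
          and u' = "\<lambda>n m. m" and v' = "\<lambda>n m. m - n", OF q];
        (simp only: minus_one_power_tri; auto; fail)?; simp add: algebra_simps two_tri tri_mult_2)
  next
    case 3
    show ?case
      by (rule theta_pair_has_sum[where u = "\<lambda>s t. s - t" and v = "\<lambda>s t. s"
          and u' = "\<lambda>n m. m" and v' = "\<lambda>n m. m - n", OF q];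
        (simp only: minus_one_power_tri; auto; fail)?; simp add: algebra_simps two_tri tri_mult_2)
  next
    case 4
    show ?case
      by (rule theta_pair_has_sum[where u = "\<lambda>s t. - 1 - s + t" and v = "\<lambda>s t. - 1 - s"
          and u' = "\<lambda>n m. - 1 - m" and v' = "\<lambda>n m. n - m", OF q];
        (simp only: minus_one_power_tri; auto; fail)?; simp add: algebra_simps two_tri tri_mult_2)
  next
    case 5
    show ?case
      by (rule theta_pair_has_sum[where u = "\<lambda>s t. - 1 - s + t" and v = "\<lambda>s t. - 1 - s"
          and u' = "\<lambda>n m. - 1 - m" and v' = "\<lambda>n m. n - m", OF q];
        (simp only: minus_one_power_tri; auto; fail)?; simp add: algebra_simps two_tri tri_mult_2)
  qed
  have lhs: "((\<lambda>(y, t). (if even t then 1 else -1) * q ^ nat (int (tri (y - t)) + 2 * t * t)) has_sum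
     (q ^ 0 * (theta (1 * q ^ 1) (1 * q ^ 0) * theta ((-1) * q ^ 2) ((-1) * q ^ 2)))) UNIV"
    by (rule theta_pair_has_sum[where u = "\<lambda>s t. s - t" and v = "\<lambda>s t. t"
          and u' = "\<lambda>n m. n + m" and v' = "\<lambda>n m. m", OF q];
        (simp only: minus_one_power_tri; auto; fail)?; simp add: algebra_simps two_tri tri_mult_2)
  have zero: "theta (-(q ^ 5)) (-1) = 0"
    using q by (intro theta_minus_one norm_power_lt_1) auto
  from has_sum_unique[OF lhs rhs] show ?thesis
    by (simp add: zero algebra_simps theta_commute[of "-(q ^ 3)"] theta_commute[of "-(q ^ 12)"] theta_commute[of "-(q ^ 4)" "-q"]
       theta_commute[of "-(q ^ 16)"] theta_commute[of 1])
qed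

lemma theta_quintic_sum_2:
  assumes q: "norm q < 1"
  shows "2 * (theta (-(q ^ 2)) (-(q ^ 3)) * theta q (-(q ^ 4)) + theta (-(q ^ 2)) (q ^ 3) * theta (-q) (-(q ^ 4)))
    = theta 1 q * theta 1 (-q)"
proof -
  have rhs: "((\<lambda>(y, t). (-1) ^ tri t * q ^ nat (int (tri (y - 1 - 2 * t)) + int (tri t))) has_sum
     ((q ^ 0 * (theta ((-1) * q ^ 3) ((-1) * q ^ 2) * theta ((-1) * q ^ 4) (1 * q ^ 1))) +
      (q ^ 0 * (theta ((-1) * q ^ 4) ((-1) * q ^ 1) * theta ((-1) * q ^ 2) (1 * q ^ 3))) +
      (q ^ 1 * (theta ((-1) * q ^ 5) ((-1) * q ^ 0) * theta ((-1) * q ^ 0) (1 * q ^ 5))) +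
      (q ^ 0 * (theta ((-1) * q ^ 4) ((-1) * q ^ 1) * theta ((-1) * q ^ 2) (1 * q ^ 3))) +
      (q ^ 0 * (theta ((-1) * q ^ 3) ((-1) * q ^ 2) * theta ((-1) * q ^ 4) (1 * q ^ 1))))) UNIV"
  \<comment> \<open>Here t = v + 2s removes the cross term, and (-1)^tri(t) = (-1)^tri(v) (-1)^s
    yields one theta with two minus signs and one with a single minus sign.\<close>
  proof (rule has_sum_mod5, goal_cases)
    case 1
    show ?case
      by (rule theta_pair_has_sum[where u = "\<lambda>s t. s" and v = "\<lambda>s t. t - 2 * s"
          and u' = "\<lambda>n m. n" and v' = "\<lambda>n m. m + 2 * n", OF q];
        (simp only: minus_one_power_tri  minus_one_power_tri_shift; auto; fail)?; simp add: algebra_simps two_tri tri_mult_2)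
  next
    case 2
    show ?case
      by (rule theta_pair_has_sum[where u = "\<lambda>s t. s" and v = "\<lambda>s t. t - 2 * s"
          and u' = "\<lambda>n m. n" and v' = "\<lambda>n m. m + 2 * n", OF q];
        (simp only: minus_one_power_tri  minus_one_power_tri_shift; auto; fail)?; simp add: algebra_simps two_tri tri_mult_2)
  next
    case 3
    show ?case
      by (rule theta_pair_has_sum[where u = "\<lambda>s t. s" and v = "\<lambda>s t. t - 2 * s"
          and u' = "\<lambda>n m. n" and v' = "\<lambda>n m. m + 2 * n", OF q];
        (simp only: minus_one_power_tri  minus_one_power_tri_shift; auto; fail)?; simp add: algebra_simps two_tri tri_mult_2)
  next
    case 4
    show ?case
      by (rule theta_pair_has_sum[where u = "\<lambda>s t. - 1 - s" and v = "\<lambda>s t. 1 + 2 * s - t"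
          and u' = "\<lambda>n m. - 1 - n" and v' = "\<lambda>n m. - 1 - m - 2 * n", OF q];
        (simp only: minus_one_power_tri  minus_one_power_tri_shift; auto; fail)?; simp add: algebra_simps two_tri tri_mult_2)
  next
    case 5
    show ?case
      by (rule theta_pair_has_sum[where u = "\<lambda>s t. - 1 - s" and v = "\<lambda>s t. 1 + 2 * s - t"
          and u' = "\<lambda>n m. - 1 - n" and v' = "\<lambda>n m. - 1 - m - 2 * n", OF q];
        (simp only: minus_one_power_tri  minus_one_power_tri_shift; auto; fail)?; simp add: algebra_simps two_tri tri_mult_2)
  qed
  have lhs: "((\<lambda>(y, t). (-1) ^ tri t * q ^ nat (int (tri (y - 1 - 2 * t)) + int (tri t))) has_sum
     (q ^ 0 * (theta (1 * q ^ 1) (1 * q ^ 0) * theta ((-1) * q ^ 1) (1 * q ^ 0)))) UNIV"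
    by (rule theta_pair_has_sum[where u = "\<lambda>s t. s - 1 - 2 * t" and v = "\<lambda>s t. t"
          and u' = "\<lambda>n m. n + 1 + 2 * m" and v' = "\<lambda>n m. m", OF q];
        (simp only: minus_one_power_tri  minus_one_power_tri_shift; auto; fail)?; simp add: algebra_simps two_tri tri_mult_2)
  have zero: "theta (-(q ^ 5)) (-1) = 0"
    using q by (intro theta_minus_one norm_power_lt_1) auto
  from has_sum_unique[OF lhs rhs] show ?thesis
    by (simp add: zero algebra_simps theta_commute[of "-(q ^ 3)"] theta_commute[of "-(q ^ 4)"] theta_commute[of 1])
qed

subsection \<open>Sums and differences of Rogers--Ramanujan products\<close>

lemma tendsto_theta:
  assumes lim: "(f \<longlongrightarrow> a) F" "(g \<longlongrightarrow> b) F"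
    and bound: "eventually (\<lambda>x. norm (f x) \<le> 1) F" "eventually (\<lambda>x. norm (g x) \<le> 1) F"
    and ab: "norm (a * b) < 1"
  shows "((\<lambda>x. theta (f x) (g x)) \<longlongrightarrow> theta a b) F"
proof -
  \<comment> \<open>Room between \<open>norm (a * b)\<close> and 1 gives one summable bound valid
    for all arguments close to the limit.\<close>
  obtain s where s: "norm (a * b) < s" "s < 1" using dense[OF ab] by blast
  have "((\<lambda>x. norm (f x * g x)) \<longlongrightarrow> norm (a * b)) F"
    by (intro tendsto_intros lim)
  hence "eventually (\<lambda>x. norm (f x * g x) < s) F"
    using s(1) by (rule order_tendstoD)
  hence "eventually (\<lambda>x. \<forall>n. norm (theta_term (f x) (g x) n) \<le> s ^ tri (\<bar>n\<bar> - 1)) F"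
    using bound by eventually_elim (use s in \<open>auto intro!: norm_theta_term_le simp: norm_mult\<close>)
  moreover have "(\<lambda>n. s ^ tri (\<bar>n\<bar> - 1)) summable_on UNIV"
    using s norm_ge_zero[of "a * b"] by (intro summable_power_tri) linarith+
  moreover have "((\<lambda>x. theta_term (f x) (g x) n) \<longlongrightarrow> theta_term a b n) F" for n
    unfolding theta_term_def by (intro tendsto_intros lim)
  ultimately show ?thesis
    unfolding theta_def by (intro infsum_tendsto_dominated)
qed

lemma continuous_on_theta:
  assumes "continuous_on S f" "continuous_on S g"
    and "\<And>x. x \<in> S \<Longrightarrow> norm (f x) \<le> 1" "\<And>x. x \<in> S \<Longrightarrow> norm (g x) \<le> 1"
    and "\<And>x. x \<in> S \<Longrightarrow> norm (f x * g x) < 1"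
  shows "continuous_on S (\<lambda>x. theta (f x) (g x))"
  unfolding continuous_on_def
proof (intro ballI tendsto_theta)
  fix x assume x: "x \<in> S"
  show "(f \<longlongrightarrow> f x) (at x within S)" "(g \<longlongrightarrow> g x) (at x within S)"
    using assms(1,2) x by (auto simp: continuous_on_def)
  show "eventually (\<lambda>x. norm (f x) \<le> 1) (at x within S)" "eventually (\<lambda>x. norm (g x) \<le> 1) (at x within S)"
    using assms(3,4) by (auto simp: eventually_at_filter)
  show "norm (f x * g x) < 1" using assms(5) x by blast
qed

lemma continuous_on_theta_powers:
  fixes S :: "complex set"
  assumes "S \<subseteq> ball 0 1" "norm c = 1" "norm d = 1" "i + j > 0"
  shows "continuous_on S (\<lambda>q. theta (c * q ^ i) (d * q ^ j))"
proof (rule continuous_on_theta)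
  fix q assume "q \<in> S"
  hence q: "norm q < 1" using assms(1) by auto
  show "norm (c * q ^ i) \<le> 1" "norm (d * q ^ j) \<le> 1"
    using q assms(2,3) by (auto simp: norm_mult norm_power power_le_one)
  have "norm (c * q ^ i * (d * q ^ j)) = norm q ^ (i + j)"
    using assms(2,3) by (simp add: norm_mult norm_power power_add)
  thus "norm (c * q ^ i * (d * q ^ j)) < 1"
    using q assms(4) by (simp add: power_less_one_iff)
qed (intro continuous_intros)+

lemma continuous_on_qpoch_inf: "continuous_on (ball 0 1) (\<lambda>q. qpoch_inf q q)"
proof (rule continuous_on_eq)
  show "continuous_on (ball 0 1) (\<lambda>q. theta (-1 * q ^ 1) (-1 * q ^ 2))"
    by (rule continuous_on_theta_powers) auto
qed (use qpoch_inf_eq_theta in auto)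

text \<open>Both functions are quotients of thetas by the nonvanishing (q;q), so their defining
  series need not be examined.\<close>

lemma continuous_on_RR: "continuous_on (ball 0 1) RR_G" "continuous_on (ball 0 1) RR_H"
proof -
  have nz: "qpoch_inf q q \<noteq> 0" if "q \<in> ball 0 1" for q
    using that qpoch_inf_nonzero[of q q] by simp
  show "continuous_on (ball 0 1) RR_G"
  proof (rule continuous_on_eq)
    show "continuous_on (ball 0 1) (\<lambda>q. theta (-1 * q ^ 2) (-1 * q ^ 3) / qpoch_inf q q)"
      using nz by (intro continuous_intros continuous_on_theta_powers continuous_on_qpoch_inf) auto
    show "theta (-1 * q ^ 2) (-1 * q ^ 3) / qpoch_inf q q = RR_G q" if "q \<in> ball 0 1" for q
      using rogers_ramanujan_G[of q] nz[OF that] that by (simp add: field_simps)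
  qed
  show "continuous_on (ball 0 1) RR_H"
  proof (rule continuous_on_eq)
    show "continuous_on (ball 0 1) (\<lambda>q. theta (-1 * q ^ 1) (-1 * q ^ 4) / qpoch_inf q q)"
      using nz by (intro continuous_intros continuous_on_theta_powers continuous_on_qpoch_inf) auto
    show "theta (-1 * q ^ 1) (-1 * q ^ 4) / qpoch_inf q q = RR_H q" if "q \<in> ball 0 1" for q
      using rogers_ramanujan_H[of q] nz[OF that] that by (simp add: field_simps)
  qed
qed

text \<open>The quotient of \<open>X\<close> by \<open>Y\<close> is continuous with values 1 and -1,
  hence constant on \<open>S\<close>; in the product over two points its square appears.\<close>

lemma mult_eq_mult_if_squares_eq:
  fixes X Y :: "complex \<Rightarrow> complex"
  assumes "connected S" "continuous_on S X" "continuous_on S Y"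
    and sq: "\<And>x. x \<in> S \<Longrightarrow> X x ^ 2 = Y x ^ 2" and nz: "\<And>x. x \<in> S \<Longrightarrow> Y x \<noteq> 0"
    and "a \<in> S" "b \<in> S"
  shows "X a * X b = Y a * Y b"
proof -
  have r: "X x / Y x \<in> {1, -1}" if "x \<in> S" for x
    using sq[OF that] nz[OF that] by (auto simp: power2_eq_iff)
  have "(\<lambda>x. X x / Y x) constant_on S"
  proof (rule continuous_finite_range_constant[OF assms(1)])
    show "continuous_on S (\<lambda>x. X x / Y x)"
      using nz by (intro continuous_intros assms) auto
    show "finite ((\<lambda>x. X x / Y x) ` S)"
      by (rule finite_subset[of _ "{1, -1}"]) (use r in blast, simp)
  qed
  hence "X a / Y a = X b / Y b"
    using assms(6,7) by (auto simp: constant_on_def)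
  thus ?thesis
    using r[OF assms(6)] r[OF assms(7)] nz[OF assms(6)] nz[OF assms(7)] by (auto simp: field_simps)
qed

text \<open>After multiplication by twice the two (q;q)-type factors, the left sides become the
  quintic theta sums, and the eta conversions cancel those factors again.\<close>

lemma RR_sum_identities:
  assumes q: "norm q < 1"
  shows "(RR_G q * RR_G (q ^ 4) + q * RR_H q * RR_H (q ^ 4)) * qpoch_inf (q ^ 2) (q ^ 2) = theta q q"
    and "(RR_G q * RR_H (-q) + RR_G (-q) * RR_H q) * qpoch_inf (q ^ 2) (q ^ 2) = theta 1 (q ^ 2)"
proof -
  let ?E1 = "qpoch_inf q q" and ?E4 = "qpoch_inf (q ^ 4) (q ^ 4)" and ?E2 = "qpoch_inf (q ^ 2) (q ^ 2)"
    and ?Em = "qpoch_inf (-q) (-q)"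
  have qm: "norm (-q) < 1" and q4: "norm (q ^ 4) < 1"
    using q by (auto simp: norm_power power_less_one_iff)
  have nz: "?E1 \<noteq> 0" "?E4 \<noteq> 0" "?Em \<noteq> 0"
    using qpoch_inf_nonzero[OF q q] qpoch_inf_nonzero[OF q4 q4] qpoch_inf_nonzero[OF qm qm] by auto
  have G: "RR_G q * ?E1 = theta (-(q ^ 2)) (-(q ^ 3))" and H: "RR_H q * ?E1 = theta (-q) (-(q ^ 4))"
    using rogers_ramanujan_G[OF q] rogers_ramanujan_H[OF q] by auto
  have G4: "RR_G (q ^ 4) * ?E4 = theta (-(q ^ 8)) (-(q ^ 12))" and H4: "RR_H (q ^ 4) * ?E4 = theta (-(q ^ 4)) (-(q ^ 16))"
    using rogers_ramanujan_G[OF q4] rogers_ramanujan_H[OF q4] by (simp_all flip: power_mult)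
  have Gm: "RR_G (-q) * ?Em = theta (-(q ^ 2)) (q ^ 3)" and Hm: "RR_H (-q) * ?Em = theta q (-(q ^ 4))"
    using rogers_ramanujan_G[OF qm] rogers_ramanujan_H[OF qm] by simp_all
  have "(2 * ?E1 * ?E4) * ((RR_G q * RR_G (q ^ 4) + q * RR_H q * RR_H (q ^ 4)) * ?E2)
      = ?E2 * (2 * ((RR_G q * ?E1) * (RR_G (q ^ 4) * ?E4) + q * (RR_H q * ?E1) * (RR_H (q ^ 4) * ?E4)))"
    by (simp add: algebra_simps)
  also have "\<dots> = (2 * ?E1 * ?E4) * theta q q"
    unfolding G H G4 H4 theta_quintic_sum_1[OF q] eta_theta_conversions(1)[OF q] by (simp add: mult_ac)
  finally show "(RR_G q * RR_G (q ^ 4) + q * RR_H q * RR_H (q ^ 4)) * ?E2 = theta q q"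
    using nz by simp
  have "(2 * ?E1 * ?Em) * ((RR_G q * RR_H (-q) + RR_G (-q) * RR_H q) * ?E2)
      = ?E2 * (2 * ((RR_G q * ?E1) * (RR_H (-q) * ?Em) + (RR_G (-q) * ?Em) * (RR_H q * ?E1)))"
    by (simp add: algebra_simps)
  also have "\<dots> = (2 * ?E1 * ?Em) * theta 1 (q ^ 2)"
    unfolding G H Gm Hm theta_quintic_sum_2[OF q] eta_theta_conversions(2)[OF q] by (simp add: mult_ac)
  finally show "(RR_G q * RR_H (-q) + RR_G (-q) * RR_H q) * ?E2 = theta 1 (q ^ 2)"
    using nz by simp
qed

text \<open>In (X - Y)^2 = (X + Y)^2 - 4 X Y the four factors of X Y are re-paired, (g g4)(h h4) as
  (g h4)(h g4) and (g h')(g' h) as (g g')(h h'), so that each new pair is a known theta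
  function.\<close>

lemma RR_difference_squares:
  assumes q: "norm q < 1"
  shows "((RR_G q * RR_G (q ^ 4) - q * RR_H q * RR_H (q ^ 4)) * qpoch_inf (q ^ 2) (q ^ 2)) ^ 2 = theta (q ^ 5) (q ^ 5) ^ 2"
    and "((RR_G q * RR_H (-q) - RR_G (-q) * RR_H q) * qpoch_inf (q ^ 2) (q ^ 2)) ^ 2 = (q * theta 1 (q ^ 10)) ^ 2"
proof -
  let ?E2 = "qpoch_inf (q ^ 2) (q ^ 2)"
  have "((RR_G q * RR_G (q ^ 4) - q * RR_H q * RR_H (q ^ 4)) * ?E2) ^ 2 =
      ((RR_G q * RR_G (q ^ 4) + q * RR_H q * RR_H (q ^ 4)) * ?E2) ^ 2 -
      4 * q * (RR_G q * RR_H (q ^ 4) * ?E2) * (RR_H q * RR_G (q ^ 4) * ?E2)"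
    by (simp add: power2_eq_square algebra_simps)
  also have "\<dots> = theta (q ^ 5) (q ^ 5) ^ 2"
    unfolding RR_sum_identities[OF q] RR_pair_products[OF q] phi_square_identity[OF q, symmetric] by simp
  finally show "((RR_G q * RR_G (q ^ 4) - q * RR_H q * RR_H (q ^ 4)) * ?E2) ^ 2 = theta (q ^ 5) (q ^ 5) ^ 2" .
  have "((RR_G q * RR_H (-q) - RR_G (-q) * RR_H q) * ?E2) ^ 2 =
      ((RR_G q * RR_H (-q) + RR_G (-q) * RR_H q) * ?E2) ^ 2 -
      4 * (RR_G q * RR_G (-q) * ?E2) * (RR_H q * RR_H (-q) * ?E2)"
    by (simp add: power2_eq_square algebra_simps)
  also have "\<dots> = (q * theta 1 (q ^ 10)) ^ 2"
    unfolding RR_sum_identities[OF q] RR_pair_products[OF q] psi_square_identity[OF q, symmetric] by simp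
  finally show "((RR_G q * RR_H (-q) - RR_G (-q) * RR_H q) * ?E2) ^ 2 = (q * theta 1 (q ^ 10)) ^ 2" .
qed

text \<open>By continuity the sign in each square root is constant on the punctured disc, so it
  disappears from the product of the values at two points.\<close>

lemma RR_difference_products:
  assumes "norm q < 1" "q \<noteq> 0" "norm p < 1" "p \<noteq> 0"
  shows "(RR_G q * RR_G (q ^ 4) - q * RR_H q * RR_H (q ^ 4)) * qpoch_inf (q ^ 2) (q ^ 2) *
         ((RR_G p * RR_G (p ^ 4) - p * RR_H p * RR_H (p ^ 4)) * qpoch_inf (p ^ 2) (p ^ 2)) =
         theta (q ^ 5) (q ^ 5) * theta (p ^ 5) (p ^ 5)"
    and "(RR_G q * RR_H (-q) - RR_G (-q) * RR_H q) * qpoch_inf (q ^ 2) (q ^ 2) *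
         ((RR_G p * RR_H (-p) - RR_G (-p) * RR_H p) * qpoch_inf (p ^ 2) (p ^ 2)) =
         q * theta 1 (q ^ 10) * (p * theta 1 (p ^ 10))"
proof -
  \<comment> \<open>The origin is removed because \<open>q * theta 1 (q ^ 10)\<close> vanishes
    there; the punctured disc is still connected.\<close>
  let ?S = "ball 0 1 - {0} :: complex set"
  have S: "connected ?S"
    by (rule connected_open_delete) auto
  have in_S: "q \<in> ?S" "p \<in> ?S" using assms by auto
  have cont: "continuous_on ?S (\<lambda>x. f (g x))" if "continuous_on (ball 0 1) f" "continuous_on ?S g" "\<And>x. norm x < 1 \<Longrightarrow> norm (g x) < 1"
    for f g :: "complex \<Rightarrow> complex"
    by (rule continuous_on_compose2[OF that(1,2)]) (use that(3) in auto)
  have pow: "norm (x ^ n) < 1" if "norm x < 1" "n > 0" for x :: complex and n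
    using norm_power_lt_1 that .
  note [continuous_intros] = cont[OF continuous_on_RR(1)] cont[OF continuous_on_RR(2)] cont[OF continuous_on_qpoch_inf]
  show "(RR_G q * RR_G (q ^ 4) - q * RR_H q * RR_H (q ^ 4)) * qpoch_inf (q ^ 2) (q ^ 2) *
         ((RR_G p * RR_G (p ^ 4) - p * RR_H p * RR_H (p ^ 4)) * qpoch_inf (p ^ 2) (p ^ 2)) =
         theta (q ^ 5) (q ^ 5) * theta (p ^ 5) (p ^ 5)"
  proof (rule mult_eq_mult_if_squares_eq[OF S _ _ _ _ in_S])
    show "continuous_on ?S (\<lambda>q. (RR_G q * RR_G (q ^ 4) - q * RR_H q * RR_H (q ^ 4)) * qpoch_inf (q ^ 2) (q ^ 2))"
      by (intro continuous_intros) (auto intro: pow)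
    show "continuous_on ?S (\<lambda>q. theta (q ^ 5) (q ^ 5))"
      using continuous_on_theta_powers[of ?S 1 1 5 5] by auto
    show "((RR_G x * RR_G (x ^ 4) - x * RR_H x * RR_H (x ^ 4)) * qpoch_inf (x ^ 2) (x ^ 2)) ^ 2 = theta (x ^ 5) (x ^ 5) ^ 2"
      if "x \<in> ?S" for x using that by (intro RR_difference_squares) auto
    show "theta (x ^ 5) (x ^ 5) \<noteq> 0" if "x \<in> ?S" for x
      using that by (auto simp: theta_diag pow kappa_def qpoch_inf_nonzero simp flip: power_mult)
  qed
  show "(RR_G q * RR_H (-q) - RR_G (-q) * RR_H q) * qpoch_inf (q ^ 2) (q ^ 2) *
         ((RR_G p * RR_H (-p) - RR_G (-p) * RR_H p) * qpoch_inf (p ^ 2) (p ^ 2)) =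
         q * theta 1 (q ^ 10) * (p * theta 1 (p ^ 10))"
  proof (rule mult_eq_mult_if_squares_eq[OF S _ _ _ _ in_S])
    show "continuous_on ?S (\<lambda>q. (RR_G q * RR_H (-q) - RR_G (-q) * RR_H q) * qpoch_inf (q ^ 2) (q ^ 2))"
      by (intro continuous_intros) (auto intro: pow)
    have "continuous_on ?S (\<lambda>q. theta 1 (q ^ 10))"
      using continuous_on_theta_powers[of ?S 1 1 0 10] by auto
    thus "continuous_on ?S (\<lambda>q. q * theta 1 (q ^ 10))"
      by (intro continuous_intros)
    show "((RR_G x * RR_H (-x) - RR_G (-x) * RR_H x) * qpoch_inf (x ^ 2) (x ^ 2)) ^ 2 = (x * theta 1 (x ^ 10)) ^ 2"
      if "x \<in> ?S" for x using that by (intro RR_difference_squares) auto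
    show "x * theta 1 (x ^ 10) \<noteq> 0" if "x \<in> ?S" for x
      using that by (auto simp: theta_one pow qpoch_inf_nonzero)
  qed
qed

section \<open>Assembly of the two identities\<close>

lemma RR_at_0 [simp]: "RR_G 0 = 1" "RR_H 0 = 1"
proof -
  have "RR_G 0 = (\<Sum>n\<in>{0}. 0 ^ (n ^ 2) / qpoch 0 0 n)"
    unfolding RR_G_def by (rule suminf_finite) auto
  thus "RR_G 0 = 1" by simp
  have "RR_H 0 = (\<Sum>n\<in>{0}. 0 ^ (n * (n + 1)) / qpoch 0 0 n)"
    unfolding RR_H_def by (rule suminf_finite) auto
  thus "RR_H 0 = 1" by simp
qed

theorem theorem4p9:
  fixes q Q :: complex
  assumes "norm q < 1"
    and "Q = q ^ 19"
  shows "4 * RR_U 1 19 q * RR_U 1 19 (q ^ 4)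
           = 3 * kappa q ^ 2 * kappa Q ^ 2 + kappa (- q) ^ 2 * kappa (- Q) ^ 2
             + 4 * q ^ 5 * (1 / (kappa (- (q ^ 2)) ^ 2 * kappa (- (Q ^ 2)) ^ 2)) \<and>
         4 * q * RR_U 1 19 q * RR_U 1 19 (- q)
           = kappa q ^ 2 * kappa Q ^ 2 - kappa (- q) ^ 2 * kappa (- Q) ^ 2
             + 12 * q ^ 5 * (1 / (kappa (- (q ^ 2)) ^ 2 * kappa (- (Q ^ 2)) ^ 2))"
proof (cases "q = 0")
  \<comment> \<open>At 0 the claims read 4 = 3 + 1 and 0 = 1 - 1.\<close>
  case True
  have "kappa 0 = 1" by (simp add: kappa_def qpoch_inf_def)
  thus ?thesis using True assms(2) by (simp add: RR_U_def)
next
  case False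
  have q: "norm q < 1" and qm: "norm (-q) < 1" using assms by auto
  have Q: "norm Q < 1" "Q \<noteq> 0" and Qm: "norm (-Q) < 1" using assms False by (auto simp: norm_power_lt_1 norm_power power_less_one_iff)
  define E where "E = qpoch_inf (q ^ 2) (q ^ 2)"
  define F where "F = qpoch_inf (Q ^ 2) (Q ^ 2)"
  have nz: "E \<noteq> 0" "F \<noteq> 0"
    unfolding E_def F_def using q Q by (simp_all add: qpoch_inf_nonzero norm_power_lt_1)
  let ?g = "RR_G q" and ?h = "RR_H q" and ?g4 = "RR_G (q ^ 4)" and ?h4 = "RR_H (q ^ 4)" and ?gm = "RR_G (-q)" and ?hm = "RR_H (-q)"
  let ?G = "RR_G Q" and ?H = "RR_H Q" and ?G4 = "RR_G (Q ^ 4)" and ?H4 = "RR_H (Q ^ 4)" and ?Gm = "RR_G (-Q)" and ?Hm = "RR_H (-Q)"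
  have Q20: "q * Q = q ^ 20" using assms(2) by (simp flip: power_Suc)
  have U: "RR_U 1 19 q = ?g * ?G + q ^ 4 * ?h * ?H"
    "RR_U 1 19 (q ^ 4) = ?g4 * ?G4 + q ^ 16 * ?h4 * ?H4"
    "RR_U 1 19 (-q) = ?gm * ?Gm + q ^ 4 * ?hm * ?Hm"
    by (simp_all add: RR_U_def assms(2) mult.commute flip: power_mult)
  have K: "kappa q ^ 2 * E = theta q q" "kappa Q ^ 2 * F = theta Q Q"
    "kappa (-q) ^ 2 * E = theta (-q) (-q)" "kappa (-Q) ^ 2 * F = theta (-Q) (-Q)"
    using theta_diag[OF q] theta_diag[OF qm] theta_diag[OF Q(1)] theta_diag[OF Qm] by (simp_all add: E_def F_def)
  have T: "1 / kappa (- (q ^ 2)) ^ 2 * E = theta 1 (q ^ 2) / 2" "1 / kappa (- (Q ^ 2)) ^ 2 * F = theta 1 (Q ^ 2) / 2"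
    using theta_one_square[OF q] theta_one_square[OF Q(1)] by (simp_all add: E_def F_def)
  note P = RR_pair_products[OF q, folded E_def] RR_pair_products[OF Q(1), folded F_def]
  note A = RR_sum_identities[OF q, folded E_def] RR_sum_identities[OF Q(1), folded F_def]
  note D = RR_difference_products[OF q False Q, folded E_def F_def]
  have Qp: "q ^ 95 = Q ^ 5" "q ^ 57 = Q ^ 3" "q ^ 133 = Q ^ 7" "q ^ 171 = Q ^ 9" "q ^ 19 = Q" "q ^ 38 = Q ^ 2"
     "q ^ 76 = Q ^ 4" "q ^ 114 = Q ^ 6" "q ^ 152 = Q ^ 8" "q ^ 190 = Q ^ 10"
    unfolding assms(2) by (simp_all flip: power_mult)
  have t: "4 * q ^ 5 * (1 / (kappa (- (q ^ 2)) ^ 2 * kappa (- (Q ^ 2)) ^ 2)) * (E * F) = q ^ 5 * theta 1 (q ^ 2) * theta 1 (Q ^ 2)"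
  proof -
    have "4 * q ^ 5 * (1 / (kappa (- (q ^ 2)) ^ 2 * kappa (- (Q ^ 2)) ^ 2)) * (E * F) =
        4 * q ^ 5 * (1 / kappa (- (q ^ 2)) ^ 2 * E) * (1 / kappa (- (Q ^ 2)) ^ 2 * F)"
      by simp
    thus ?thesis unfolding T by simp
  qed
  have "4 * RR_U 1 19 q * RR_U 1 19 (q ^ 4) * (E * F) =
      2 * ((?g * ?g4 + q * ?h * ?h4) * E * ((?G * ?G4 + Q * ?H * ?H4) * F) +
           (?g * ?g4 - q * ?h * ?h4) * E * ((?G * ?G4 - Q * ?H * ?H4) * F)) +
      4 * q ^ 4 * (?h * ?g4 * E) * (?H * ?G4 * F) + 4 * q ^ 16 * (?g * ?h4 * E) * (?G * ?H4 * F)"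
  proof -
    \<comment> \<open>The polarisation: its two products contribute \<open>u * v\<close> to the term
      b d b' d', against \<open>x * y\<close> on the left.\<close>
    have "4 * (a * a' + x * b * b') * (c * c' + y * d * d') * (E * F) =
        2 * ((a * c + u * b * d) * E * ((a' * c' + v * b' * d') * F) +
             (a * c - u * b * d) * E * ((a' * c' - v * b' * d') * F)) +
        4 * x * (b * c * E) * (b' * c' * F) + 4 * y * (a * d * E) * (a' * d' * F)"
      if "x * y = u * v" for a a' b b' c c' d d' x y u v :: complex
    proof -
      have "4 * (a * a' + x * b * b') * (c * c' + y * d * d') * (E * F) =
          4 * (a * c * a' * c' + (x * y) * (b * d * b' * d')) * (E * F) +
          4 * x * (b * c * E) * (b' * c' * F) + 4 * y * (a * d * E) * (a' * d' * F)"
        by (simp add: algebra_simps)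
      thus ?thesis unfolding that by (simp add: algebra_simps)
    qed
    moreover have "q ^ 4 * q ^ 16 = q * Q" unfolding Q20 by simp
    ultimately show ?thesis unfolding U by blast
  qed
  also have "\<dots> = 2 * (theta q q * theta Q Q + theta (q ^ 5) (q ^ 5) * theta (Q ^ 5) (Q ^ 5)) +
      4 * q ^ 4 * theta (q ^ 3) (q ^ 7) * theta (Q ^ 3) (Q ^ 7) + 4 * q ^ 16 * theta q (q ^ 9) * theta Q (Q ^ 9)"
    unfolding P A D ..
  \<comment> \<open>Two copies of phi(q) phi(Q) come from the sum identities and a third from the
    theta relation.\<close>
  also have "\<dots> = 3 * (theta q q * theta Q Q) + theta (-q) (-q) * theta (-Q) (-Q) + q ^ 5 * theta 1 (q ^ 2) * theta 1 (Q ^ 2)"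
    using theta_form_4_2_5[OF q] unfolding Qp by (simp add: algebra_simps)
  also have "\<dots> = (3 * kappa q ^ 2 * kappa Q ^ 2 + kappa (- q) ^ 2 * kappa (- Q) ^ 2
             + 4 * q ^ 5 * (1 / (kappa (- (q ^ 2)) ^ 2 * kappa (- (Q ^ 2)) ^ 2))) * (E * F)"
    unfolding distrib_right t K[symmetric] by (simp add: mult_ac)
  finally have 1: "4 * RR_U 1 19 q * RR_U 1 19 (q ^ 4)
           = 3 * kappa q ^ 2 * kappa Q ^ 2 + kappa (- q) ^ 2 * kappa (- Q) ^ 2
             + 4 * q ^ 5 * (1 / (kappa (- (q ^ 2)) ^ 2 * kappa (- (Q ^ 2)) ^ 2))"
    using nz by simp
  have "4 * q * RR_U 1 19 q * RR_U 1 19 (-q) * (E * F) =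
      4 * q * (?g * ?gm * E) * (?G * ?Gm * F) + 4 * q ^ 9 * (?h * ?hm * E) * (?H * ?Hm * F) +
      2 * q ^ 5 * ((?g * ?hm + ?gm * ?h) * E * ((?G * ?Hm + ?Gm * ?H) * F) +
           (?g * ?hm - ?gm * ?h) * E * ((?G * ?Hm - ?Gm * ?H) * F))"
  proof -
    \<comment> \<open>Both mixed terms carry the same \<open>x\<close>, so this polarisation needs
      no side condition.\<close>
    have "4 * q * (a * a' + x * b * b') * (c * c' + x * d * d') * (E * F) =
        4 * q * (a * c * E) * (a' * c' * F) + 4 * (q * x * x) * (b * d * E) * (b' * d' * F) +
        2 * (q * x) * ((a * d + c * b) * E * ((a' * d' + c' * b') * F) +
             (a * d - c * b) * E * ((a' * d' - c' * b') * F))"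
      for a a' b b' c c' d d' x :: complex
      by (simp add: algebra_simps)
    moreover have "q * q ^ 4 * q ^ 4 = q ^ 9" "q * q ^ 4 = q ^ 5"
      by (simp_all add: eval_nat_numeral)
    ultimately show ?thesis unfolding U by metis
  qed
  also have "\<dots> = 4 * q * theta (q ^ 4) (q ^ 6) * theta (Q ^ 4) (Q ^ 6) + 4 * q ^ 9 * theta (q ^ 2) (q ^ 8) * theta (Q ^ 2) (Q ^ 8) +
      2 * q ^ 5 * (theta 1 (q ^ 2) * theta 1 (Q ^ 2) + q * theta 1 (q ^ 10) * (Q * theta 1 (Q ^ 10)))"
    unfolding P A D ..
  \<comment> \<open>Two copies of the psi product come from the sum identities and one from the
    theta relation; as each is worth 4 reciprocal kappa terms, the coefficient becomes 12.\<close>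
  also have "\<dots> = theta q q * theta Q Q - theta (-q) (-q) * theta (-Q) (-Q) + 3 * (q ^ 5 * theta 1 (q ^ 2) * theta 1 (Q ^ 2))"
  proof -
    have e: "q * A * (Q * B) = q ^ 20 * (A * B)" for A B
      unfolding Q20[symmetric] by (simp add: mult_ac)
    have split: "2 * q ^ 5 * (theta 1 (q ^ 2) * theta 1 (Q ^ 2) + q * theta 1 (q ^ 10) * (Q * theta 1 (Q ^ 10))) =
        2 * q ^ 5 * theta 1 (q ^ 2) * theta 1 (Q ^ 2) + 2 * q ^ 25 * theta 1 (q ^ 10) * theta 1 (Q ^ 10)"
      unfolding e by (simp add: algebra_simps)
    show ?thesis
      unfolding split
      using theta_form_1_1_5[OF q] unfolding Qp by (simp add: algebra_simps)
  qed
  also have "\<dots> = (kappa q ^ 2 * kappa Q ^ 2 - kappa (- q) ^ 2 * kappa (- Q) ^ 2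
             + 12 * q ^ 5 * (1 / (kappa (- (q ^ 2)) ^ 2 * kappa (- (Q ^ 2)) ^ 2))) * (E * F)"
    unfolding t[symmetric] K[symmetric] by (simp add: algebra_simps)
  finally have 2: "4 * q * RR_U 1 19 q * RR_U 1 19 (-q)
           = kappa q ^ 2 * kappa Q ^ 2 - kappa (- q) ^ 2 * kappa (- Q) ^ 2
             + 12 * q ^ 5 * (1 / (kappa (- (q ^ 2)) ^ 2 * kappa (- (Q ^ 2)) ^ 2))"
    using nz by simp
  from 1 2 show ?thesis by blast
qed

end
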